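(* Let $(M,\Phi)$ be a uniformly expanding NAIFS on a compact connected Riemannian manifold $M$ with uniform expansion factor $\sigma>1$ and injectivity constant $\rho>0$. Then $(M,\Phi)$ satisfies the specification property.
   Context: NAIFS: A non-autonomous iterated function system (NAIFS) on $M$ is a pair $(M,\Phi)$ where $\Phi=\{\Phi^{(j)}\}_{j\ge 1}$, $\Phi^{(j)}=\{\varphi_i^{(j)}:M\to M\}_{i\in I^{(j)}}$ is a collection of maps and $I^{(j)}$ is a non-empty finite index set. Put $I^{1,\infty}:=\prod_{j=1}^\infty I^{(j)}$ (infinite words $w=w_1w_2\cdots$). For $w\in I^{1,\infty}$ and $k\ge1$ put $\varphi_w^{1,k}:=\varphi_{w_k}^{(k)}\circ\cdots\circ\varphi_{w_1}^{(1)}$, $\varphi_w^{1,0}:=\mathrm{id}_M$. Let $d$ be the Riemannian distance on $M$ and $B(p,r)$ the open ball. Expanding maps: a $C^1$-local diffeomorphism $f:M\to M$ is expanding if there are $\sigma>1$ and some Riemannian metric on $M$ with $\|Df(x)v\|\ge\sigma\|v\|$ for every $x\in M$ and every tangent vector $v$ at $x$. For $\sigma>1$, $\rho>0$, $\mathcal E(\sigma,\rho)$ denotes the set of all expanding $C^1$-local diffeomorphisms $f$ of $M$ with expansion factor $\sigma$ and injectivity constant $\rho$, meaning: for every $p\in M$ the image $f(B(p,\rho))$ contains a neighbourhood of the closure of $B(f(p),\rho)$ and $d(f(x),f(y))\ge\sigma d(x,y)$ for all $x,y\in B(p,\rho)$; moreover, for any pre-image $x$ of any point $y\in M$ there is a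 $C^1$ map $h:B(y,\rho)\to M$ (inverse branch) with $f\circ h=\mathrm{id}$, $h(y)=x$ and $d(h(y_1),h(y_2))\le\sigma^{-1}d(y_1,y_2)$ for all $y_1,y_2\in B(y,\rho)$. Uniformly expanding: $(M,\Phi)$ is uniformly expanding with uniform expansion factor $\sigma$ and injectivity constant $\rho$ if $\varphi_i^{(j)}\in\mathcal E(\sigma,\rho)$ for all $j\ge1$, $i\in I^{(j)}$. Specification property: for every $\delta>0$ there is $N(\delta)\in\mathbb N$ such that for each $w\in I^{1,\infty}$, any $x_1,\dots,x_s\in M$ with $s\ge2$ and any integers $0=j_1\le k_1<j_2\le k_2<\cdots<j_s\le k_s$ with $j_{n+1}-k_n\ge N(\delta)$ for $n=1,\dots,s-1$, there is $x\in M$ with $d(\varphi_w^{1,i}(x),\varphi_w^{1,i}(x_m))\le\delta$ for each $1\le m\le s$ and all $j_m\le i\le k_m$. *)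

theory Defs
  imports "HOL-Analysis.Analysis"
begin

section \<open>Smooth functions on open subsets of normed spaces\<close>

text \<open>Meaningful for open \<open>S\<close> (the derivatives are full, not relative to \<open>S\<close>).\<close>

primrec Ck_on :: "nat \<Rightarrow> 'a::real_normed_vector set \<Rightarrow> ('a \<Rightarrow> 'b::real_normed_vector) \<Rightarrow> bool" where
  "Ck_on 0 S f \<longleftrightarrow> continuous_on S f"
| "Ck_on (Suc k) S f \<longleftrightarrow>
     (\<forall>x\<in>S. f differentiable (at x)) \<and> (\<forall>v. Ck_on k S (\<lambda>x. frechet_derivative f (at x) v))"

definition smooth_on :: "'a::real_normed_vector set \<Rightarrow> ('a \<Rightarrow> 'b::real_normed_vector) \<Rightarrow> bool" where
  "smooth_on S f \<longleftrightarrow> (\<forall>k. Ck_on k S f)"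


section \<open>Riemannian manifolds\<close>

text \<open>
  The manifold is a whole type \<open>'m\<close>, Hausdorff and second countable, with a smooth atlas modelled on
  the Euclidean space \<open>'e\<close>.  A chart is a pair of its domain and its coordinate map; values of the
  coordinate map off the domain are irrelevant.
\<close>

type_synonym ('m, 'e) chart = "'m set \<times> ('m \<Rightarrow> 'e)"

abbreviation chart_dom :: "('m, 'e) chart \<Rightarrow> 'm set" where
  "chart_dom \<equiv> fst"

abbreviation chart_map :: "('m, 'e) chart \<Rightarrow> 'm \<Rightarrow> 'e" where
  "chart_map \<equiv> snd"

definition chart_inv :: "('m, 'e) chart \<Rightarrow> 'e \<Rightarrow> 'm" where
  "chart_inv c = inv_into (chart_dom c) (chart_map c)"

definition smooth_atlas ::
  "('m::{t2_space,second_countable_topology}, 'e::euclidean_space) chart set \<Rightarrow> bool" where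
  "smooth_atlas A \<longleftrightarrow>
     (\<forall>c\<in>A. open (chart_dom c) \<and> open (chart_map c ` chart_dom c) \<and>
        homeomorphism (chart_dom c) (chart_map c ` chart_dom c) (chart_map c) (chart_inv c)) \<and>
     (\<Union>c\<in>A. chart_dom c) = UNIV \<and>
     (\<forall>c\<in>A. \<forall>c'\<in>A.
        smooth_on (chart_map c ` (chart_dom c \<inter> chart_dom c')) (chart_map c' \<circ> chart_inv c))"

text \<open>
  A tangent vector at \<open>p\<close> is the family of its coordinate vectors in all charts around \<open>p\<close>, related
  by the derivatives of the transition maps (and \<open>0\<close> at the other arguments, so that the family is
  determined by the tangent vector).
\<close>

type_synonym ('m, 'e) tvector = "('m, 'e) chart \<Rightarrow> 'e"

definition tangent_space ::
  "('m::{t2_space,second_countable_topology}, 'e::euclidean_space) chart set \<Rightarrow> 'm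
     \<Rightarrow> ('m, 'e) tvector set" where
  "tangent_space A p =
     {v. (\<forall>c. c \<notin> A \<or> p \<notin> chart_dom c \<longrightarrow> v c = 0) \<and>
         (\<forall>c\<in>A. \<forall>c'\<in>A. p \<in> chart_dom c \<longrightarrow> p \<in> chart_dom c' \<longrightarrow>
            v c' = frechet_derivative (chart_map c' \<circ> chart_inv c) (at (chart_map c p)) (v c))}"

text \<open>The tangent vector at \<open>p\<close> whose coordinate vector in the chart \<open>c\<close> is \<open>a\<close>.\<close>

definition coord_tvector ::
  "('m::{t2_space,second_countable_topology}, 'e::euclidean_space) chart set \<Rightarrow> ('m, 'e) chart
     \<Rightarrow> 'm \<Rightarrow> 'e \<Rightarrow> ('m, 'e) tvector" where
  "coord_tvector A c p a =
     (\<lambda>c'. if c' \<in> A \<and> p \<in> chart_dom c'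
           then frechet_derivative (chart_map c' \<circ> chart_inv c) (at (chart_map c p)) a else 0)"

text \<open>
  A smooth field of inner products on the tangent spaces.  By symmetry, linearity is only stated
  in the first argument.
\<close>

type_synonym ('m, 'e) rmetric = "'m \<Rightarrow> ('m, 'e) tvector \<Rightarrow> ('m, 'e) tvector \<Rightarrow> real"

definition riemannian_metric ::
  "('m::{t2_space,second_countable_topology}, 'e::euclidean_space) chart set
     \<Rightarrow> ('m, 'e) rmetric \<Rightarrow> bool" where
  "riemannian_metric A g \<longleftrightarrow>
     (\<forall>p. \<forall>u\<in>tangent_space A p. \<forall>v\<in>tangent_space A p.
        g p u v = g p v u \<and>
        (\<forall>w\<in>tangent_space A p. \<forall>a b.
           g p (\<lambda>c. a *\<^sub>R u c + b *\<^sub>R v c) w = a * g p u w + b * g p v w)) \<and>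
     (\<forall>p. \<forall>v\<in>tangent_space A p. v \<noteq> (\<lambda>_. 0) \<longrightarrow> g p v v > 0) \<and>
     (\<forall>c\<in>A. \<forall>a b. smooth_on (chart_map c ` chart_dom c)
        (\<lambda>x. g (chart_inv c x) (coord_tvector A c (chart_inv c x) a)
                               (coord_tvector A c (chart_inv c x) b)))"

definition riemannian_manifold ::
  "('m::{t2_space,second_countable_topology}, 'e::euclidean_space) chart set
     \<Rightarrow> ('m, 'e) rmetric \<Rightarrow> bool" where
  "riemannian_manifold A g \<longleftrightarrow> smooth_atlas A \<and> riemannian_metric A g"

definition tnorm :: "('m, 'e) rmetric \<Rightarrow> 'm \<Rightarrow> ('m, 'e) tvector \<Rightarrow> real" where
  "tnorm g p v = sqrt (g p v v)"


section \<open>Riemannian distance\<close>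

text \<open>Derivatives are one-sided at the end points of the closed interval.\<close>

definition C1_curve_on ::
  "('m::{t2_space,second_countable_topology}, 'e::euclidean_space) chart set
     \<Rightarrow> (real \<Rightarrow> 'm) \<Rightarrow> real \<Rightarrow> real \<Rightarrow> bool" where
  "C1_curve_on A \<gamma> a b \<longleftrightarrow>
     continuous_on {a..b} \<gamma> \<and>
     (\<forall>c\<in>A. \<exists>D. continuous_on {t\<in>{a..b}. \<gamma> t \<in> chart_dom c} D \<and>
        (\<forall>t\<in>{a..b}. \<gamma> t \<in> chart_dom c \<longrightarrow>
           ((chart_map c \<circ> \<gamma>) has_vector_derivative D t) (at t within {a..b})))"

definition piecewise_C1_curve ::
  "('m::{t2_space,second_countable_topology}, 'e::euclidean_space) chart set
     \<Rightarrow> (real \<Rightarrow> 'm) \<Rightarrow> bool" where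
  "piecewise_C1_curve A \<gamma> \<longleftrightarrow>
     (\<exists>n (\<tau> :: nat \<Rightarrow> real). \<tau> 0 = 0 \<and> \<tau> n = 1 \<and>
        (\<forall>i<n. \<tau> i < \<tau> (Suc i) \<and> C1_curve_on A \<gamma> (\<tau> i) (\<tau> (Suc i))))"

text \<open>
  Unspecified at the finitely many times where the curve is not differentiable; these do not
  contribute to the length.
\<close>

definition velocity ::
  "('m::{t2_space,second_countable_topology}, 'e::euclidean_space) chart set
     \<Rightarrow> (real \<Rightarrow> 'm) \<Rightarrow> real \<Rightarrow> ('m, 'e) tvector" where
  "velocity A \<gamma> t =
     (\<lambda>c. if c \<in> A \<and> \<gamma> t \<in> chart_dom c then vector_derivative (chart_map c \<circ> \<gamma>) (at t) else 0)"

definition curve_length ::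
  "('m::{t2_space,second_countable_topology}, 'e::euclidean_space) chart set
     \<Rightarrow> ('m, 'e) rmetric \<Rightarrow> (real \<Rightarrow> 'm) \<Rightarrow> real" where
  "curve_length A g \<gamma> = integral {0..1} (\<lambda>t. tnorm g (\<gamma> t) (velocity A \<gamma> t))"

text \<open>The set of lengths is nonempty when the manifold is connected.\<close>

definition riemannian_dist ::
  "('m::{t2_space,second_countable_topology}, 'e::euclidean_space) chart set
     \<Rightarrow> ('m, 'e) rmetric \<Rightarrow> 'm \<Rightarrow> 'm \<Rightarrow> real" where
  "riemannian_dist A g x y =
     Inf {curve_length A g \<gamma> | \<gamma>. piecewise_C1_curve A \<gamma> \<and> \<gamma> 0 = x \<and> \<gamma> 1 = y}"

definition rball ::
  "('m::{t2_space,second_countable_topology}, 'e::euclidean_space) chart set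
     \<Rightarrow> ('m, 'e) rmetric \<Rightarrow> 'm \<Rightarrow> real \<Rightarrow> 'm set" where
  "rball A g p r = {q. riemannian_dist A g p q < r}"


section \<open>Expanding local diffeomorphisms\<close>

definition C1_map_on ::
  "('m::{t2_space,second_countable_topology}, 'e::euclidean_space) chart set
     \<Rightarrow> 'm set \<Rightarrow> ('m \<Rightarrow> 'm) \<Rightarrow> bool" where
  "C1_map_on A W f \<longleftrightarrow>
     continuous_on W f \<and>
     (\<forall>c\<in>A. \<forall>c'\<in>A. Ck_on 1 (chart_map c ` {p \<in> W \<inter> chart_dom c. f p \<in> chart_dom c'})
                           (chart_map c' \<circ> f \<circ> chart_inv c))"

definition C1_local_diffeo ::
  "('m::{t2_space,second_countable_topology}, 'e::euclidean_space) chart set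
     \<Rightarrow> ('m \<Rightarrow> 'm) \<Rightarrow> bool" where
  "C1_local_diffeo A f \<longleftrightarrow>
     (\<forall>p. \<exists>V. open V \<and> p \<in> V \<and> open (f ` V) \<and> inj_on f V \<and>
        C1_map_on A V f \<and> C1_map_on A (f ` V) (inv_into V f))"

text \<open>The choice of the chart \<open>c\<close> around \<open>p\<close> is immaterial for tangent vectors \<open>v\<close> at \<open>p\<close>.\<close>

definition differential ::
  "('m::{t2_space,second_countable_topology}, 'e::euclidean_space) chart set
     \<Rightarrow> ('m \<Rightarrow> 'm) \<Rightarrow> 'm \<Rightarrow> ('m, 'e) tvector \<Rightarrow> ('m, 'e) tvector" where
  "differential A f p v =
     (let c = (SOME c. c \<in> A \<and> p \<in> chart_dom c) in
      (\<lambda>c'. if c' \<in> A \<and> f p \<in> chart_dom c'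
            then frechet_derivative (chart_map c' \<circ> f \<circ> chart_inv c) (at (chart_map c p)) (v c)
            else 0))"

definition expanding ::
  "('m::{t2_space,second_countable_topology}, 'e::euclidean_space) chart set
     \<Rightarrow> ('m \<Rightarrow> 'm) \<Rightarrow> bool" where
  "expanding A f \<longleftrightarrow>
     C1_local_diffeo A f \<and>
     (\<exists>\<sigma>>1. \<exists>g. riemannian_metric A g \<and>
        (\<forall>x. \<forall>v\<in>tangent_space A x. tnorm g (f x) (differential A f x v) \<ge> \<sigma> * tnorm g x v))"

text \<open>
  The set $\mathcal{E}(\sigma,\rho)$.  Distances and balls are those of the fixed metric \<open>g\<close>, whereas
  \<open>expanding\<close> may be witnessed by another metric and another factor.
\<close>

definition expanding_maps ::
  "('m::{t2_space,second_countable_topology}, 'e::euclidean_space) chart set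
     \<Rightarrow> ('m, 'e) rmetric \<Rightarrow> real \<Rightarrow> real \<Rightarrow> ('m \<Rightarrow> 'm) set" where
  "expanding_maps A g \<sigma> \<rho> =
     {f. expanding A f \<and>
         (\<forall>p. (\<exists>V. open V \<and> closure (rball A g (f p) \<rho>) \<subseteq> V \<and> V \<subseteq> f ` rball A g p \<rho>) \<and>
              (\<forall>x\<in>rball A g p \<rho>. \<forall>y\<in>rball A g p \<rho>.
                 riemannian_dist A g (f x) (f y) \<ge> \<sigma> * riemannian_dist A g x y)) \<and>
         (\<forall>y x. f x = y \<longrightarrow>
            (\<exists>h. C1_map_on A (rball A g y \<rho>) h \<and>
                 (\<forall>z\<in>rball A g y \<rho>. f (h z) = z) \<and> h y = x \<and>
                 (\<forall>y1\<in>rball A g y \<rho>. \<forall>y2\<in>rball A g y \<rho>.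
                    riemannian_dist A g (h y1) (h y2) \<le> inverse \<sigma> * riemannian_dist A g y1 y2)))}"


section \<open>Non-autonomous iterated function systems\<close>

text \<open>
  \<open>I j\<close> is the index set and \<open>\<Phi> j i\<close> (for \<open>i \<in> I j\<close>) the maps at time \<open>j \<ge> 1\<close>; the values at
  \<open>j = 0\<close> are not used.
\<close>

definition naifs :: "(nat \<Rightarrow> 'i set) \<Rightarrow> (nat \<Rightarrow> 'i \<Rightarrow> 'm \<Rightarrow> 'm) \<Rightarrow> bool" where
  "naifs I \<Phi> \<longleftrightarrow> (\<forall>j\<ge>1. finite (I j) \<and> I j \<noteq> {})"

definition words :: "(nat \<Rightarrow> 'i set) \<Rightarrow> (nat \<Rightarrow> 'i) set" where
  "words I = Pi\<^sub>E {1..} I"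

primrec naifs_iter :: "(nat \<Rightarrow> 'i \<Rightarrow> 'm \<Rightarrow> 'm) \<Rightarrow> (nat \<Rightarrow> 'i) \<Rightarrow> nat \<Rightarrow> 'm \<Rightarrow> 'm" where
  "naifs_iter \<Phi> w 0 = id"
| "naifs_iter \<Phi> w (Suc k) = \<Phi> (Suc k) (w (Suc k)) \<circ> naifs_iter \<Phi> w k"

definition uniformly_expanding ::
  "('m::{t2_space,second_countable_topology}, 'e::euclidean_space) chart set
     \<Rightarrow> ('m, 'e) rmetric \<Rightarrow> real \<Rightarrow> real
     \<Rightarrow> (nat \<Rightarrow> 'i set) \<Rightarrow> (nat \<Rightarrow> 'i \<Rightarrow> 'm \<Rightarrow> 'm) \<Rightarrow> bool" where
  "uniformly_expanding A g \<sigma> \<rho> I \<Phi> \<longleftrightarrow> (\<forall>j\<ge>1. \<forall>i\<in>I j. \<Phi> j i \<in> expanding_maps A g \<sigma> \<rho>)"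

definition specification_property ::
  "('m \<Rightarrow> 'm \<Rightarrow> real) \<Rightarrow> (nat \<Rightarrow> 'i set) \<Rightarrow> (nat \<Rightarrow> 'i \<Rightarrow> 'm \<Rightarrow> 'm) \<Rightarrow> bool" where
  "specification_property d I \<Phi> \<longleftrightarrow>
     (\<forall>\<delta>>0. \<exists>N::nat. \<forall>w\<in>words I. \<forall>s\<ge>2. \<forall>(xs :: nat \<Rightarrow> 'm) (j :: nat \<Rightarrow> nat) (k :: nat \<Rightarrow> nat).
        j 1 = 0 \<and> (\<forall>n\<in>{1..s}. j n \<le> k n) \<and>
        (\<forall>n\<in>{1..<s}. k n < j (Suc n) \<and> j (Suc n) - k n \<ge> N) \<longrightarrow>
        (\<exists>x. \<forall>m\<in>{1..s}. \<forall>i\<in>{j m..k m}. d (naifs_iter \<Phi> w i x) (naifs_iter \<Phi> w i (xs m)) \<le> \<delta>))"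

end

theory Submission
  imports Defs
begin

text \<open>
  Specification for an expanding system rests on two properties of the inverse branches on balls of
  radius \<open>\<rho>\<close>, which contract distances by the factor \<open>\<sigma>\<close>.

  A point \<open>z\<close> that is \<open>\<epsilon>\<close>-close, with \<open>\<epsilon> < \<rho>\<close>, to the end of an orbit segment can be pulled back
  along that segment, and its preimages stay \<open>\<epsilon>\<close>-close to the segment (\<open>orbit_pullback\<close>).

  The system is exact, uniformly in time and in the word.  A compact connected manifold has a number \<open>n\<close>
  such that any two points are joined by a chain of \<open>n\<close> steps shorter than \<open>\<rho>\<close>
  (\<open>uniform_chain_length\<close>).  To hit a given target \<open>q\<close> after \<open>l\<close> more maps, starting close to a given
  point, join the image of that point to \<open>q\<close> by such a chain and lift the chain \<open>l\<close> times.  The lifted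
  chain starts at the given point, its steps are shorter than \<open>\<rho> / \<sigma> ^ l\<close>, and it ends at a point that
  is mapped to \<open>q\<close> (\<open>lift_chain\<close>, \<open>orbit_exact\<close>).

  The shadowing point is then found by going through the blocks from the last one to the first one:
  exactness bridges the gap in front of the next block and the pull-back follows the present block
  (\<open>specification_of_contracting_branches\<close>).

  These arguments are purely metric.  Of the Riemannian distance they use that it vanishes on the
  diagonal, satisfies the triangle inequality and is small near the diagonal in the manifold topology.
  The triangle inequality comes from the concatenation of curves, together with the nonnegativity of
  lengths, for which velocities have to be recognized as tangent vectors; the local smallness comes from
  straight segments in charts, in which the metric has bounded coefficients.
\<close>

section \<open>Chains and inverse branches\<close>

text \<open>
  A step must be short in both directions: this makes the relation symmetric even when the distance
  function \<open>d\<close> is not.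
\<close>

definition step_rel :: "('m \<Rightarrow> 'm \<Rightarrow> real) \<Rightarrow> real \<Rightarrow> ('m \<times> 'm) set" where
  "step_rel d r = {(p, q). d p q < r \<and> d q p < r}"

lemma sym_step_rel: "sym (step_rel d r)"
  by (auto simp: sym_def step_rel_def)

lemma relpow_sym:
  assumes "sym R" "(p, q) \<in> R ^^ n"
  shows "(q, p) \<in> R ^^ n"
  using assms(2)
proof (induction n arbitrary: q)
  case (Suc n)
  then obtain r where "(p, r) \<in> R ^^ n" "(r, q) \<in> R"
    by auto
  then show ?case
    using Suc.IH assms(1) relpow_Suc_I2 symD by metis
qed auto

text \<open>
  The sets of points reached from a base point in \<open>n\<close> steps exhaust the space by connectedness,
  and each of them lies in the interior of the next.  By compactness one of them is the whole space;
  running chains backwards by symmetry, any two points are then joined through the base point.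
\<close>

lemma uniform_chain_length:
  fixes R :: "('m::topological_space \<times> 'm) set"
  assumes "compact (UNIV :: 'm set)" "connected (UNIV :: 'm set)"
    and sym: "sym R"
    and nhd: "\<And>p. \<exists>U. open U \<and> p \<in> U \<and> (\<forall>q\<in>U. (p, q) \<in> R)"
  shows "\<exists>n. \<forall>p q. (p, q) \<in> R ^^ n"
proof -
  obtain U where U: "\<And>p. open (U p)" "\<And>p. p \<in> U p" "\<And>p q. q \<in> U p \<Longrightarrow> (p, q) \<in> R"
    using nhd by metis
  fix p0 :: 'm
  define V where "V n = {q. (p0, q) \<in> R ^^ n}" for n
  define W where "W n = (\<Union>q\<in>V n. U q)" for n
  have openW: "open (W n)" for n
    using U(1) by (auto simp: W_def)
  have VW: "V n \<subseteq> W n" for n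
    using U(2) by (auto simp: W_def)
  have WV: "W n \<subseteq> V (Suc n)" for n
    using U(3) by (auto simp: W_def V_def)
  have mono: "W n \<subseteq> W m" if "n \<le> m" for n m
    using that
  proof (induction rule: dec_induct)
    case (step k)
    then show ?case using VW[of "Suc k"] WV[of k] by blast
  qed auto
  have "\<exists>n. (p0, q) \<in> R ^^ n" for q
  proof (rule connected_equivalence_relation[OF assms(2), of p0 q "\<lambda>x y. \<exists>n. (x, y) \<in> R ^^ n"])
    show "\<exists>T. openin (top_of_set UNIV) T \<and> p \<in> T \<and> (\<forall>q\<in>T. \<exists>n. (p, q) \<in> R ^^ n)" for p
      using U(1,2)[of p] U(3) by (intro exI[of _ "U p"]) (auto intro!: exI[of _ "1::nat"])
  next
    show "\<exists>n. (x, z) \<in> R ^^ n" if "\<exists>n. (x, y) \<in> R ^^ n" "\<exists>n. (y, z) \<in> R ^^ n" for x y z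
      using that by (metis relcompI relpow_add)
  qed (use relpow_sym[OF sym] in auto)
  then have cover: "(\<Union>n. W n) = UNIV"
    using VW unfolding V_def by blast
  obtain F where F: "finite F" "UNIV = (\<Union>n\<in>F. W n)"
    using compactE_image[OF assms(1), of UNIV W] openW cover by (metis UNIV_I subset_UNIV subset_antisym)
  then have "W (Max F) = UNIV"
    using mono Max_ge[OF F(1)] by blast
  then have all: "(p0, q) \<in> R ^^ Suc (Max F)" for q
    using WV[of "Max F"] by (auto simp: V_def)
  have "(p, q) \<in> R ^^ (Suc (Max F) + Suc (Max F))" for p q
    using relpow_sym[OF sym all[of p]] all[of q] relpow_add[of "Suc (Max F)" "Suc (Max F)" R]
    by blast
  then show ?thesis by blast
qed

lemma chain_dist_le:
  assumes "\<And>x. d x x = 0" and "\<And>x y z. d x z \<le> d x y + d y z"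
    and "(p, q) \<in> step_rel d r ^^ n"
  shows "d p q \<le> real n * r" "d q p \<le> real n * r"
proof -
  have "d p q \<le> real n * r \<and> d q p \<le> real n * r"
    using assms(3)
  proof (induction n arbitrary: q)
    case (Suc n)
    then obtain u where u: "(p, u) \<in> step_rel d r ^^ n" "(u, q) \<in> step_rel d r" by auto
    have "d p q \<le> d p u + d u q" "d q p \<le> d q u + d u p" using assms(2) by blast+
    then show ?case
      using Suc.IH[OF u(1)] u(2) by (auto simp: step_rel_def algebra_simps)
  qed (simp add: assms(1))
  then show "d p q \<le> real n * r" "d q p \<le> real n * r" by auto
qed

text \<open>
  The metric part of the inverse-branch condition that defines \<open>expanding_maps\<close>, one branch for each point
  \<open>x\<close> over its image \<open>f x\<close>.
\<close>

definition contracting_branches :: "('m \<Rightarrow> 'm \<Rightarrow> real) \<Rightarrow> real \<Rightarrow> real \<Rightarrow> ('m \<Rightarrow> 'm) \<Rightarrow> bool" where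
  "contracting_branches d \<sigma> \<rho> f \<longleftrightarrow>
     (\<forall>x. \<exists>h. h (f x) = x \<and> (\<forall>z. d (f x) z < \<rho> \<longrightarrow> f (h z) = z) \<and>
        (\<forall>z z'. d (f x) z < \<rho> \<longrightarrow> d (f x) z' < \<rho> \<longrightarrow> d (h z) (h z') \<le> d z z' / \<sigma>))"

lemma lift_point:
  assumes "contracting_branches d \<sigma> \<rho> f" "\<rho> > 0" "\<And>x. d x x = 0" "d (f x) q < \<rho>"
  obtains x' where "f x' = q" "d x x' \<le> d (f x) q / \<sigma>" "d x' x \<le> d q (f x) / \<sigma>"
proof -
  obtain h where h: "h (f x) = x" "\<And>z. d (f x) z < \<rho> \<Longrightarrow> f (h z) = z"
    "\<And>z z'. d (f x) z < \<rho> \<Longrightarrow> d (f x) z' < \<rho> \<Longrightarrow> d (h z) (h z') \<le> d z z' / \<sigma>"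
    using assms(1) unfolding contracting_branches_def by metis
  have "d (f x) (f x) < \<rho>" using assms by simp
  then show thesis
    using that[of "h q"] h(2)[OF assms(4)] h(3)[of "f x" q] h(3)[of q "f x"] assms(4) h(1) by simp
qed

text \<open>
  A chain is lifted step by step, each time with the inverse branch at the lift of the previous point,
  so that every step shrinks by the factor \<open>\<sigma>\<close>.  This is the discrete form of lifting a path
  through a covering map.
\<close>

lemma lift_chain:
  assumes "contracting_branches d \<sigma> \<rho> f" "\<sigma> > 0" "\<rho> > 0" "\<And>x. d x x = 0" "r \<le> \<rho>"
    and "(f x, q) \<in> step_rel d r ^^ n"
  shows "\<exists>x'. f x' = q \<and> (x, x') \<in> step_rel d (r / \<sigma>) ^^ n"
  using assms(6)
proof (induction n arbitrary: q)
  case (Suc n)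
  then obtain u where u: "(f x, u) \<in> step_rel d r ^^ n" "d u q < r" "d q u < r"
    by (auto simp: step_rel_def)
  obtain u' where u': "f u' = u" "(x, u') \<in> step_rel d (r / \<sigma>) ^^ n"
    using Suc.IH[OF u(1)] by blast
  obtain q' where q': "f q' = q" "d u' q' \<le> d (f u') q / \<sigma>" "d q' u' \<le> d q (f u') / \<sigma>"
    using lift_point[OF assms(1,3,4), of u' q] u u'(1) assms(5) by auto
  have "d (f u') q / \<sigma> < r / \<sigma>" "d q (f u') / \<sigma> < r / \<sigma>"
    using u u'(1) assms(2) by (auto simp: divide_strict_right_mono)
  with q' have "(u', q') \<in> step_rel d (r / \<sigma>)" by (auto simp: step_rel_def)
  with u'(2) q'(1) show ?case by (metis relpow_Suc_I)
qed auto

section \<open>Specification from contracting inverse branches\<close>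

text \<open>
  Uniform exactness.  If \<open>r\<close>-chains of length \<open>n\<close> connect everything, any target \<open>q\<close> at time \<open>k + l\<close> is
  hit from a point \<open>y\<close> whose distance to the given orbit at time \<open>k\<close> is exponentially small in \<open>l\<close>.
  The conclusion speaks of all \<open>u\<close> that pass through \<open>y\<close> at time \<open>k\<close>, which expresses the evolution from
  time \<open>k\<close> to time \<open>k + l\<close> in terms of orbits that start at time \<open>0\<close>; no such \<open>u\<close> has to be
  exhibited before the construction has reached time \<open>0\<close>, where every point qualifies.
\<close>

lemma orbit_exact:
  assumes "\<And>j. j \<ge> 1 \<Longrightarrow> contracting_branches d \<sigma> \<rho> (\<Phi> j (w j))" "\<sigma> > 1" "\<rho> > 0" "\<And>x. d x x = 0"
    and "0 < r" "r \<le> \<rho>"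
    and "(naifs_iter \<Phi> w (k + l) x, q) \<in> step_rel d r ^^ n"
  shows "\<exists>y. (naifs_iter \<Phi> w k x, y) \<in> step_rel d (r / \<sigma> ^ l) ^^ n \<and>
             (\<forall>u. naifs_iter \<Phi> w k u = y \<longrightarrow> naifs_iter \<Phi> w (k + l) u = q)"
  using assms(5-7)
proof (induction l arbitrary: q r)
  case (Suc l)
  have "(\<Phi> (Suc (k + l)) (w (Suc (k + l))) (naifs_iter \<Phi> w (k + l) x), q) \<in> step_rel d r ^^ n"
    using Suc.prems(3) by simp
  then obtain q' where q': "\<Phi> (Suc (k + l)) (w (Suc (k + l))) q' = q"
    "(naifs_iter \<Phi> w (k + l) x, q') \<in> step_rel d (r / \<sigma>) ^^ n"
    using lift_chain[OF assms(1) _ assms(3,4) Suc.prems(2)] assms(2) by fastforce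
  have "r * 1 \<le> \<rho> * \<sigma>" using assms(2) Suc.prems by (intro mult_mono) auto
  then have "0 < r / \<sigma>" "r / \<sigma> \<le> \<rho>" using assms(2) Suc.prems by (auto simp: divide_simps)
  from Suc.IH[OF this q'(2)] q'(1) show ?case by (auto simp: field_simps)
qed auto

text \<open>
  The inverse branches along the orbit of \<open>x\<close> pull a point \<open>z\<close> near the end of an orbit segment back
  to its beginning, and they do not increase the distance to the orbit of \<open>x\<close>.
\<close>

lemma orbit_pullback:
  assumes "\<And>j. j \<ge> 1 \<Longrightarrow> contracting_branches d \<sigma> \<rho> (\<Phi> j (w j))" "\<sigma> > 1" "\<rho> > 0" "\<And>x. d x x = 0"
    and "0 \<le> \<epsilon>" "\<epsilon> < \<rho>"
    and "d (naifs_iter \<Phi> w (a + l) x) z \<le> \<epsilon>" "d z (naifs_iter \<Phi> w (a + l) x) \<le> \<epsilon>"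
  shows "\<exists>y. \<forall>u. naifs_iter \<Phi> w a u = y \<longrightarrow> naifs_iter \<Phi> w (a + l) u = z \<and>
               (\<forall>i\<in>{a..a + l}. d (naifs_iter \<Phi> w i u) (naifs_iter \<Phi> w i x) \<le> \<epsilon>)"
  using assms(7,8)
proof (induction l arbitrary: z)
  case 0
  then show ?case by (intro exI[of _ z]) auto
next
  case (Suc l)
  let ?f = "\<Phi> (Suc (a + l)) (w (Suc (a + l)))" and ?v = "naifs_iter \<Phi> w (a + l) x"
  have z: "d (?f ?v) z \<le> \<epsilon>" "d z (?f ?v) \<le> \<epsilon>" using Suc.prems by auto
  then obtain z' where z': "?f z' = z" "d ?v z' \<le> d (?f ?v) z / \<sigma>" "d z' ?v \<le> d z (?f ?v) / \<sigma>"
    using lift_point[OF assms(1) assms(3,4), of "Suc (a + l)" ?v z] assms(6) by auto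
  have shrink: "t / \<sigma> \<le> \<epsilon>" if "t \<le> \<epsilon>" for t
  proof -
    have "\<epsilon> * 1 \<le> \<epsilon> * \<sigma>" using assms(2,5) by (intro mult_left_mono) auto
    with that assms(2) show ?thesis by (simp add: divide_simps)
  qed
  have "d ?v z' \<le> \<epsilon>" "d z' ?v \<le> \<epsilon>"
    using z' shrink[OF z(1)] shrink[OF z(2)] by linarith+
  from Suc.IH[OF this] obtain y where y: "\<And>u. naifs_iter \<Phi> w a u = y \<Longrightarrow>
     naifs_iter \<Phi> w (a + l) u = z' \<and>
       (\<forall>i\<in>{a..a + l}. d (naifs_iter \<Phi> w i u) (naifs_iter \<Phi> w i x) \<le> \<epsilon>)" by blast
  have "naifs_iter \<Phi> w (a + Suc l) u = z \<and>
      (\<forall>i\<in>{a..a + Suc l}. d (naifs_iter \<Phi> w i u) (naifs_iter \<Phi> w i x) \<le> \<epsilon>)"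
    if "naifs_iter \<Phi> w a u = y" for u
    using y[OF that] z'(1) z(2) by (auto simp: le_Suc_eq)
  then show ?case by blast
qed

text \<open>
  The shadowing orbit is built backwards in time, so that errors do not accumulate: given the point at
  which block \<open>m + 1\<close> has to be entered, exactness provides a point close to the end of block \<open>m\<close> that
  is carried exactly there, and pulling this point back along block \<open>m\<close> gives the entry point of block \<open>m\<close>.
  The gap \<open>N\<close> is chosen so that a chain of \<open>n\<close> steps of size \<open>\<rho> / \<sigma> ^ N\<close> has total length
  at most \<open>\<epsilon>\<close>.
\<close>

lemma specification_of_contracting_branches:
  fixes d :: "'m::topological_space \<Rightarrow> 'm \<Rightarrow> real"
  assumes "compact (UNIV :: 'm set)" "connected (UNIV :: 'm set)"
    and refl: "\<And>x. d x x = 0" and tri: "\<And>x y z. d x z \<le> d x y + d y z"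
    and nhd: "\<And>p. \<exists>U. open U \<and> p \<in> U \<and> (\<forall>q\<in>U. d p q < \<rho> \<and> d q p < \<rho>)"
    and "\<sigma> > 1" "\<rho> > 0"
    and branches: "\<And>j i. j \<ge> 1 \<Longrightarrow> i \<in> I j \<Longrightarrow> contracting_branches d \<sigma> \<rho> (\<Phi> j i)"
  shows "specification_property d I \<Phi>"
  unfolding specification_property_def
proof (intro allI impI)
  fix \<delta> :: real assume "\<delta> > 0"
  \<comment> \<open>below \<open>\<rho>\<close>, so that all shadowing takes place in the domains of the inverse branches\<close>
  define \<epsilon> where "\<epsilon> = min \<delta> (\<rho> / 2)"
  have \<epsilon>: "0 < \<epsilon>" "\<epsilon> \<le> \<delta>" "\<epsilon> < \<rho>" using \<open>\<delta> > 0\<close> \<open>\<rho> > 0\<close> by (auto simp: \<epsilon>_def)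
  have "\<exists>n. \<forall>p q. (p, q) \<in> step_rel d \<rho> ^^ n"
    using assms(1,2) sym_step_rel nhd
    by (intro uniform_chain_length) (auto simp: step_rel_def)
  then obtain n where n: "\<And>p q. (p, q) \<in> step_rel d \<rho> ^^ n" by blast
  obtain N where N: "real n * \<rho> / \<epsilon> < \<sigma> ^ N" using real_arch_pow \<open>\<sigma> > 1\<close> by blast
  show "\<exists>N. \<forall>w\<in>words I. \<forall>s\<ge>2. \<forall>xs j k.
        j 1 = 0 \<and> (\<forall>n\<in>{1..s}. j n \<le> k n) \<and>
        (\<forall>n\<in>{1..<s}. k n < j (Suc n) \<and> j (Suc n) - k n \<ge> N) \<longrightarrow>
        (\<exists>x. \<forall>m\<in>{1..s}. \<forall>i\<in>{j m..k m}. d (naifs_iter \<Phi> w i x) (naifs_iter \<Phi> w i (xs m)) \<le> \<delta>)"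
  proof (intro exI[of _ N] ballI allI impI)
    fix w s and xs :: "nat \<Rightarrow> 'm" and j k :: "nat \<Rightarrow> nat"
    assume w: "w \<in> words I" and s: "2 \<le> s"
      and jk: "j 1 = 0 \<and> (\<forall>n\<in>{1..s}. j n \<le> k n) \<and>
        (\<forall>n\<in>{1..<s}. k n < j (Suc n) \<and> j (Suc n) - k n \<ge> N)"
    let ?\<phi> = "naifs_iter \<Phi> w"
    let ?shadows = "\<lambda>u m. \<forall>i\<in>{j m..k m}. d (?\<phi> i u) (?\<phi> i (xs m)) \<le> \<epsilon>"
    have br: "contracting_branches d \<sigma> \<rho> (\<Phi> j (w j))" if "j \<ge> 1" for j
      using branches that w by (auto simp: words_def)
    have block: "\<exists>y. \<forall>u. ?\<phi> (j m) u = y \<longrightarrow> ?\<phi> (k m) u = z \<and> ?shadows u m"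
      if "m \<in> {1..s}" "d (?\<phi> (k m) (xs m)) z \<le> \<epsilon>" "d z (?\<phi> (k m) (xs m)) \<le> \<epsilon>" for m z
      using orbit_pullback[where \<Phi>=\<Phi> and w=w and a="j m" and l="k m - j m" and x="xs m" and z=z,
          OF br \<open>\<sigma> > 1\<close> \<open>\<rho> > 0\<close> refl less_imp_le[OF \<epsilon>(1)] \<epsilon>(3)] that jk by simp
    \<comment> \<open>downward induction on the block that is entered at \<open>y\<close>\<close>
    have "\<exists>y. \<forall>u. ?\<phi> (j m) u = y \<longrightarrow> (\<forall>m'\<in>{m..s}. ?shadows u m')" if "1 \<le> m" "m \<le> s" for m
      using that(2,1)
    proof (induction rule: inc_induct)
      case base
      then show ?case using block[of s "?\<phi> (k s) (xs s)"] s refl \<epsilon>(1) by fastforce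
    next
      case (step m)
      then obtain y where y: "\<And>u. ?\<phi> (j (Suc m)) u = y \<Longrightarrow> \<forall>m'\<in>{Suc m..s}. ?shadows u m'"
        by auto
      define l where "l = j (Suc m) - k m"
      have "k m < j (Suc m)" "N \<le> j (Suc m) - k m" using jk step by auto
      then have l: "N \<le> l" "k m + l = j (Suc m)" by (auto simp: l_def)
      obtain z where z: "(?\<phi> (k m) (xs m), z) \<in> step_rel d (\<rho> / \<sigma> ^ l) ^^ n"
        "\<And>u. ?\<phi> (k m) u = z \<Longrightarrow> ?\<phi> (j (Suc m)) u = y"
        using orbit_exact[where \<Phi>=\<Phi> and w=w and k="k m" and l=l and x="xs m" and r=\<rho>,
            OF br \<open>\<sigma> > 1\<close> \<open>\<rho> > 0\<close> refl \<open>\<rho> > 0\<close> order_refl n] l by metis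
      have "\<sigma> ^ N \<le> \<sigma> ^ l" using l \<open>\<sigma> > 1\<close> by (intro power_increasing) auto
      with N have "real n * \<rho> / \<epsilon> \<le> \<sigma> ^ l" by linarith
      then have small: "real n * (\<rho> / \<sigma> ^ l) \<le> \<epsilon>"
        using \<epsilon>(1) \<open>\<sigma> > 1\<close> by (simp add: divide_simps mult.commute)
      have "\<exists>y. \<forall>u. ?\<phi> (j m) u = y \<longrightarrow> ?\<phi> (k m) u = z \<and> ?shadows u m"
        using chain_dist_le[OF refl tri z(1)] small step by (intro block) auto
      then obtain y' where y': "\<And>u. ?\<phi> (j m) u = y' \<Longrightarrow> ?\<phi> (k m) u = z \<and> ?shadows u m" by blast
      have "\<forall>m'\<in>{m..s}. ?shadows u m'" if "?\<phi> (j m) u = y'" for u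
        using y'[OF that] y[OF z(2)] by (metis atLeastAtMost_iff le_antisym not_less_eq_eq)
      then show ?case by blast
    qed
    from this[of 1] s jk obtain y where "\<forall>m\<in>{1..s}. ?shadows y m" by auto
    then show "\<exists>x. \<forall>m\<in>{1..s}. \<forall>i\<in>{j m..k m}. d (?\<phi> i x) (?\<phi> i (xs m)) \<le> \<delta>"
      using \<epsilon>(2) by (meson order_trans)
  qed
qed


section \<open>Tangent vectors and transition maps\<close>

context
  fixes A :: "('m::{t2_space,second_countable_topology}, 'e::euclidean_space) chart set"
  assumes atlas: "smooth_atlas A"
begin

lemma open_chart_dom: "c \<in> A \<Longrightarrow> open (chart_dom c)"
  using atlas by (auto simp: smooth_atlas_def)

lemma chart_homeomorphism:
  "c \<in> A \<Longrightarrow> homeomorphism (chart_dom c) (chart_map c ` chart_dom c) (chart_map c) (chart_inv c)"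
  using atlas by (auto simp: smooth_atlas_def)

lemma chart_inv_map: "c \<in> A \<Longrightarrow> p \<in> chart_dom c \<Longrightarrow> chart_inv c (chart_map c p) = p"
  using chart_homeomorphism homeomorphism_apply1 by blast

lemma open_chart_image:
  assumes "c \<in> A" "open U" "U \<subseteq> chart_dom c"
  shows "open (chart_map c ` U)"
proof -
  have "openin (top_of_set (chart_dom c)) U"
    using assms by (simp add: open_openin_trans open_chart_dom)
  then have "openin (top_of_set (chart_map c ` chart_dom c)) (chart_map c ` U)"
    using homeomorphism_imp_open_map[OF chart_homeomorphism] assms(1) by blast
  moreover have "open (chart_map c ` chart_dom c)"
    using atlas assms(1) by (auto simp: smooth_atlas_def)
  ultimately show ?thesis by (rule openin_open_trans)
qed

lemma transition_Ck:
  "c \<in> A \<Longrightarrow> c' \<in> A \<Longrightarrow>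
    Ck_on k (chart_map c ` (chart_dom c \<inter> chart_dom c')) (chart_map c' \<circ> chart_inv c)"
  using atlas by (auto simp: smooth_atlas_def smooth_on_def)

lemma transition_has_derivative:
  assumes "c \<in> A" "c' \<in> A" "p \<in> chart_dom c" "p \<in> chart_dom c'"
  shows "(chart_map c' \<circ> chart_inv c has_derivative
            frechet_derivative (chart_map c' \<circ> chart_inv c) (at (chart_map c p))) (at (chart_map c p))"
  using transition_Ck[OF assms(1,2), of "Suc 0"] assms(3,4)
  by (auto simp: frechet_derivative_works)

lemma continuous_transition_derivative:
  assumes "c \<in> A" "c' \<in> A"
  shows "continuous_on (chart_map c ` (chart_dom c \<inter> chart_dom c'))
           (\<lambda>x. frechet_derivative (chart_map c' \<circ> chart_inv c) (at x) v)"
  using transition_Ck[OF assms, of "Suc 0"] by auto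

text \<open>
  The chain rule for \<open>chart_map c' \<circ> \<gamma> = (chart_map c' \<circ> chart_inv c) \<circ> (chart_map c \<circ> \<gamma>)\<close>.  The
  equation holds only while \<open>\<gamma>\<close> stays in the domain of \<open>c\<close>, hence the continuity assumption.
\<close>

lemma has_vector_derivative_other_chart:
  assumes "c \<in> A" "c' \<in> A" "\<gamma> t \<in> chart_dom c" "\<gamma> t \<in> chart_dom c'"
    and "continuous (at t within S) \<gamma>" "t \<in> S"
    and "((chart_map c \<circ> \<gamma>) has_vector_derivative v) (at t within S)"
  shows "((chart_map c' \<circ> \<gamma>) has_vector_derivative
            frechet_derivative (chart_map c' \<circ> chart_inv c) (at (chart_map c (\<gamma> t))) v) (at t within S)"
proof -
  let ?T = "chart_map c' \<circ> chart_inv c"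
  let ?D = "frechet_derivative ?T (at (chart_map c (\<gamma> t)))"
  have D: "(?T has_derivative ?D) (at ((chart_map c \<circ> \<gamma>) t))"
    using transition_has_derivative[OF assms(1-4)] by simp
  have "((chart_map c \<circ> \<gamma>) has_derivative (\<lambda>s. s *\<^sub>R v)) (at t within S)"
    using assms(7) by (simp add: has_vector_derivative_def)
  from diff_chain_within[OF this has_derivative_at_withinI[OF D]]
  have "(?T \<circ> (chart_map c \<circ> \<gamma>) has_derivative ?D \<circ> (\<lambda>s. s *\<^sub>R v)) (at t within S)" .
  moreover have "?D \<circ> (\<lambda>s. s *\<^sub>R v) = (\<lambda>s. s *\<^sub>R ?D v)"
    using linear_cmul[OF has_derivative_linear[OF D]] by (auto simp: fun_eq_iff)
  moreover have "\<forall>\<^sub>F s in at t within S. (?T \<circ> (chart_map c \<circ> \<gamma>)) s = (chart_map c' \<circ> \<gamma>) s"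
  proof -
    have "\<forall>\<^sub>F s in at t within S. \<gamma> s \<in> chart_dom c"
      using assms(5) open_chart_dom[OF assms(1)] assms(3)
      by (auto simp: continuous_within dest: topological_tendstoD)
    then show ?thesis
      by eventually_elim (simp add: chart_inv_map[OF assms(1)])
  qed
  ultimately show ?thesis
    unfolding has_vector_derivative_def
    using has_derivative_transform_eventually[of "?T \<circ> (chart_map c \<circ> \<gamma>)" _ t S "chart_map c' \<circ> \<gamma>"]
      assms(6) chart_inv_map[OF assms(1,3)] by simp
qed

lemma velocity_eq_coord_tvector:
  assumes "c \<in> A" "\<gamma> t \<in> chart_dom c" "isCont \<gamma> t"
    and "((chart_map c \<circ> \<gamma>) has_vector_derivative v) (at t)"
  shows "velocity A \<gamma> t = coord_tvector A c (\<gamma> t) v"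
  unfolding velocity_def coord_tvector_def
  using has_vector_derivative_other_chart[OF assms(1) _ assms(2) _ assms(3) UNIV_I assms(4)]
  by (auto simp: fun_eq_iff vector_derivative_at)

text \<open>
  Every coordinate vector is the velocity of a curve, namely of a straight line in the chart.
\<close>

lemma coord_line:
  fixes a :: 'e
  assumes "c \<in> A" "p \<in> chart_dom c"
  defines "\<gamma> \<equiv> \<lambda>s. chart_inv c (chart_map c p + s *\<^sub>R a)"
  shows "\<gamma> 0 = p" "isCont \<gamma> 0" "((chart_map c \<circ> \<gamma>) has_vector_derivative a) (at 0)"
proof -
  let ?l = "\<lambda>s. chart_map c p + s *\<^sub>R a" and ?W = "chart_map c ` chart_dom c"
  show "\<gamma> 0 = p" using assms by (simp add: chart_inv_map)
  have W: "open ?W" using open_chart_image assms(1) open_chart_dom by blast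
  have "continuous_on ?W (chart_inv c)"
    by (rule homeomorphism_cont2[OF chart_homeomorphism[OF assms(1)]])
  then have inv: "isCont (chart_inv c) (?l 0)"
    using W assms(2) by (simp add: continuous_on_eq_continuous_at)
  have "isCont ?l 0" by (intro continuous_intros)
  from isCont_o2[OF this inv] show "isCont \<gamma> 0"
    unfolding \<gamma>_def .
  have l: "(?l has_vector_derivative a) (at 0)"
    by (auto intro!: derivative_eq_intros)
  have "open (?l -` ?W)" 
    by (intro open_vimage W continuous_intros)
  then show "((chart_map c \<circ> \<gamma>) has_vector_derivative a) (at 0)"
  proof (rule has_vector_derivative_transform_within_open[OF l])
    show "0 \<in> ?l -` ?W" using assms(2) by simp
  next
    fix s assume "s \<in> ?l -` ?W"
    then obtain q where "q \<in> chart_dom c" "?l s = chart_map c q" by blast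
    then show "?l s = (chart_map c \<circ> \<gamma>) s"
      using chart_inv_map[OF assms(1)] by (simp add: \<gamma>_def)
  qed
qed

text \<open>
  Compatibility of the coordinates in two further charts is a cocycle identity between derivatives of
  transition maps.  It follows from the uniqueness of the derivative of a straight line in the chart \<open>c\<close>,
  read off in \<open>c''\<close> either directly or by way of \<open>c'\<close>.
\<close>

lemma coord_tvector_in_tangent_space:
  assumes "c \<in> A" "p \<in> chart_dom c"
  shows "coord_tvector A c p a \<in> tangent_space A p"
proof -
  obtain \<gamma> :: "real \<Rightarrow> 'm" where \<gamma>: "\<gamma> 0 = p" "isCont \<gamma> 0"
    "((chart_map c \<circ> \<gamma>) has_vector_derivative a) (at 0)"
    by (rule that[OF coord_line[OF assms, of a]])
  have compatible: "coord_tvector A c p a c'' =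
      frechet_derivative (chart_map c'' \<circ> chart_inv c') (at (chart_map c' p)) (coord_tvector A c p a c')"
    if c': "c' \<in> A" "p \<in> chart_dom c'" and c'': "c'' \<in> A" "p \<in> chart_dom c''" for c' c''
  proof -
    have v: "((chart_map b \<circ> \<gamma>) has_vector_derivative coord_tvector A c p a b) (at 0)"
      if "b \<in> A" "p \<in> chart_dom b" for b
      using has_vector_derivative_other_chart[OF assms(1) that(1), where \<gamma>=\<gamma> and t=0 and S=UNIV] \<gamma> that assms
      by (simp add: coord_tvector_def)
    have "((chart_map c'' \<circ> \<gamma>) has_vector_derivative
        frechet_derivative (chart_map c'' \<circ> chart_inv c') (at (chart_map c' p)) (coord_tvector A c p a c'))
        (at 0)"
      using has_vector_derivative_other_chart[OF c'(1) c''(1), where \<gamma>=\<gamma> and t=0 and S=UNIV]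
        \<gamma> v[OF c'] c' c'' by simp
    with v[OF c''] show ?thesis by (rule vector_derivative_unique_at)
  qed
  show ?thesis
    unfolding tangent_space_def
  proof (intro CollectI conjI allI ballI impI)
    fix b assume "b \<notin> A \<or> p \<notin> chart_dom b"
    then show "coord_tvector A c p a b = 0" by (auto simp: coord_tvector_def)
  next
    fix c' c'' assume "c' \<in> A" "c'' \<in> A" "p \<in> chart_dom c'" "p \<in> chart_dom c''"
    then show "coord_tvector A c p a c'' =
      frechet_derivative (chart_map c'' \<circ> chart_inv c') (at (chart_map c' p)) (coord_tvector A c p a c')"
      by (intro compatible)
  qed
qed

lemma coord_tvector_linear:
  assumes "c \<in> A" "p \<in> chart_dom c"
  shows "coord_tvector A c p (a *\<^sub>R x + b *\<^sub>R y) =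
           (\<lambda>c'. a *\<^sub>R coord_tvector A c p x c' + b *\<^sub>R coord_tvector A c p y c')"
proof
  fix c'
  show "coord_tvector A c p (a *\<^sub>R x + b *\<^sub>R y) c' =
     a *\<^sub>R coord_tvector A c p x c' + b *\<^sub>R coord_tvector A c p y c'"
  proof (cases "c' \<in> A \<and> p \<in> chart_dom c'")
    case True
    then have "linear (frechet_derivative (chart_map c' \<circ> chart_inv c) (at (chart_map c p)))"
      by (intro has_derivative_linear[OF transition_has_derivative] assms) auto
    then show ?thesis
      using True by (simp add: coord_tvector_def linear_add linear_cmul)
  qed (auto simp: coord_tvector_def)
qed

end

section \<open>Norms of tangent vectors\<close>

text \<open>The first fundamental form in the chart.\<close>

definition coord_metric ::
  "('m::{t2_space,second_countable_topology}, 'e::euclidean_space) chart set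
     \<Rightarrow> ('m, 'e) rmetric \<Rightarrow> ('m, 'e) chart \<Rightarrow> 'e \<Rightarrow> 'e \<Rightarrow> 'e \<Rightarrow> real" where
  "coord_metric A g c x a b =
     g (chart_inv c x) (coord_tvector A c (chart_inv c x) a) (coord_tvector A c (chart_inv c x) b)"

context
  fixes A :: "('m::{t2_space,second_countable_topology}, 'e::euclidean_space) chart set"
    and g :: "('m, 'e) rmetric"
  assumes manifold: "riemannian_manifold A g"
begin

lemma manifold_smooth_atlas: "smooth_atlas A"
  and manifold_riemannian_metric: "riemannian_metric A g"
  using manifold by (auto simp: riemannian_manifold_def)

lemma metric_sym: "u \<in> tangent_space A p \<Longrightarrow> v \<in> tangent_space A p \<Longrightarrow> g p u v = g p v u"
  using manifold_riemannian_metric by (auto simp: riemannian_metric_def)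

lemma metric_linear:
  "u \<in> tangent_space A p \<Longrightarrow> v \<in> tangent_space A p \<Longrightarrow> w \<in> tangent_space A p \<Longrightarrow>
     g p (\<lambda>c. a *\<^sub>R u c + b *\<^sub>R v c) w = a * g p u w + b * g p v w"
  using manifold_riemannian_metric by (auto simp: riemannian_metric_def)

lemma tnorm_nonneg:
  assumes "v \<in> tangent_space A p"
  shows "tnorm g p v \<ge> 0"
proof (cases "v = (\<lambda>_. 0)")
  case True
  then show ?thesis using metric_linear[OF assms assms assms, of 0 0] by (simp add: tnorm_def)
next
  case False
  then have "g p v v > 0" using manifold_riemannian_metric assms by (auto simp: riemannian_metric_def)
  then show ?thesis by (simp add: tnorm_def)
qed

lemma coord_metric_linear:
  assumes "c \<in> A" "x \<in> chart_map c ` chart_dom c"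
  shows "linear (\<lambda>a. coord_metric A g c x a b)" "linear (\<lambda>b. coord_metric A g c x a b)"
proof -
  obtain q where "q \<in> chart_dom c" "x = chart_map c q" using assms(2) by blast
  then have p: "chart_inv c x \<in> chart_dom c"
    using chart_inv_map[OF manifold_smooth_atlas assms(1)] by simp
  note T = coord_tvector_in_tangent_space[OF manifold_smooth_atlas assms(1) p]
  have *: "coord_metric A g c x (r *\<^sub>R u + s *\<^sub>R v) b = r * coord_metric A g c x u b + s * coord_metric A g c x v b"
    for r s u v b
    by (simp add: coord_metric_def coord_tvector_linear[OF manifold_smooth_atlas assms(1) p] metric_linear[OF T T T])
  show lin: "linear (\<lambda>a. coord_metric A g c x a b)" for b
    using *[of 1 _ 1] *[of _ _ 0] by (intro linearI) auto
  have swap: "(\<lambda>b. coord_metric A g c x a b) = (\<lambda>b. coord_metric A g c x b a)"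
    unfolding coord_metric_def by (rule ext) (rule metric_sym[OF T T])
  show "linear (\<lambda>b. coord_metric A g c x a b)"
    by (rule ssubst[where P=linear, OF swap lin])
qed

text \<open>
  The finitely many coefficients of the first fundamental form are continuous, hence bounded on \<open>K\<close>;
  bilinearity turns this into a bound for the quadratic form.
\<close>

lemma coord_metric_bounded:
  assumes "c \<in> A" "compact K" "K \<subseteq> chart_map c ` chart_dom c"
  shows "\<exists>C\<ge>0. \<forall>x\<in>K. \<forall>a. coord_metric A g c x a a \<le> C * (norm a)\<^sup>2"
proof -
  have "\<exists>B. \<forall>x\<in>K. \<bar>coord_metric A g c x i j\<bar> \<le> B" for i j
  proof -
    have "\<forall>c\<in>A. \<forall>a b. smooth_on (chart_map c ` chart_dom c) (\<lambda>x. coord_metric A g c x a b)"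
      using manifold_riemannian_metric unfolding riemannian_metric_def coord_metric_def by (elim conjE)
    then have "smooth_on (chart_map c ` chart_dom c) (\<lambda>x. coord_metric A g c x i j)"
      using assms(1) by (elim ballE allE) auto
    then have "Ck_on 0 (chart_map c ` chart_dom c) (\<lambda>x. coord_metric A g c x i j)"
      unfolding smooth_on_def by (rule spec)
    then have "continuous_on K (\<lambda>x. coord_metric A g c x i j)"
      using assms(3) continuous_on_subset by auto
    then have "bounded ((\<lambda>x. coord_metric A g c x i j) ` K)"
      using assms(2) compact_continuous_image compact_imp_bounded by blast
    then show ?thesis by (auto simp: bounded_iff)
  qed
  then obtain B where B: "\<And>i j x. x \<in> K \<Longrightarrow> \<bar>coord_metric A g c x i j\<bar> \<le> B i j" by metis
  define C where "C = (\<Sum>i\<in>Basis. \<Sum>j\<in>Basis. \<bar>B i j\<bar>)"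
  have "coord_metric A g c x a a \<le> C * (norm a)\<^sup>2" if "x \<in> K" for x a
  proof -
    have x: "x \<in> chart_map c ` chart_dom c" using that assms(3) by blast
    have "coord_metric A g c x a a = coord_metric A g c x (\<Sum>i\<in>Basis. (a \<bullet> i) *\<^sub>R i) a"
      by (simp add: euclidean_representation)
    also have "\<dots> = (\<Sum>i\<in>Basis. (a \<bullet> i) * coord_metric A g c x i a)"
      by (simp add: linear_sum[OF coord_metric_linear(1)[OF assms(1) x]]
          linear_cmul[OF coord_metric_linear(1)[OF assms(1) x]])
    also have "\<dots> = (\<Sum>i\<in>Basis. (a \<bullet> i) * coord_metric A g c x i (\<Sum>j\<in>Basis. (a \<bullet> j) *\<^sub>R j))"
      by (simp add: euclidean_representation)
    also have "\<dots> = (\<Sum>i\<in>Basis. \<Sum>j\<in>Basis. (a \<bullet> i) * ((a \<bullet> j) * coord_metric A g c x i j))"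
      by (simp add: linear_sum[OF coord_metric_linear(2)[OF assms(1) x]]
          linear_cmul[OF coord_metric_linear(2)[OF assms(1) x]] sum_distrib_left)
    also have "\<dots> \<le> (\<Sum>i\<in>Basis. \<Sum>j\<in>Basis. \<bar>B i j\<bar> * (norm a)\<^sup>2)"
    proof (intro sum_mono)
      fix i j :: 'e assume "i \<in> Basis" "j \<in> Basis"
      then have "\<bar>a \<bullet> i\<bar> * (\<bar>a \<bullet> j\<bar> * \<bar>coord_metric A g c x i j\<bar>) \<le> norm a * (norm a * \<bar>B i j\<bar>)"
        using B[OF that, of i j] by (intro mult_mono) (auto simp: Basis_le_norm)
      then show "(a \<bullet> i) * ((a \<bullet> j) * coord_metric A g c x i j) \<le> \<bar>B i j\<bar> * (norm a)\<^sup>2"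
        by (simp add: power2_eq_square abs_mult[symmetric] mult_ac) 
    qed
    also have "\<dots> = C * (norm a)\<^sup>2"
      by (simp add: C_def sum_distrib_right)
    finally show ?thesis .
  qed
  moreover have "C \<ge> 0" by (auto simp: C_def intro!: sum_nonneg)
  ultimately show ?thesis by blast
qed

end


section \<open>Lengths of curves\<close>

text \<open>
  At these times the velocity is a genuine tangent vector; at other times its coordinates may be
  unspecified.
\<close>

definition regular_time ::
  "('m::{t2_space,second_countable_topology}, 'e::euclidean_space) chart set
     \<Rightarrow> (real \<Rightarrow> 'm) \<Rightarrow> real \<Rightarrow> bool" where
  "regular_time A \<gamma> t \<longleftrightarrow>
     isCont \<gamma> t \<and> (\<forall>c\<in>A. \<gamma> t \<in> chart_dom c \<longrightarrow> (chart_map c \<circ> \<gamma>) differentiable (at t))"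

abbreviation speed ::
  "('m::{t2_space,second_countable_topology}, 'e::euclidean_space) chart set
     \<Rightarrow> ('m, 'e) rmetric \<Rightarrow> (real \<Rightarrow> 'm) \<Rightarrow> real \<Rightarrow> real" where
  "speed A g \<gamma> t \<equiv> tnorm g (\<gamma> t) (velocity A \<gamma> t)"

lemma in_some_piece:
  fixes \<tau> :: "nat \<Rightarrow> real"
  assumes "\<tau> 0 \<le> t" "t \<le> \<tau> n" "t \<notin> \<tau> ` {..n}"
  shows "\<exists>i<n. \<tau> i < t \<and> t < \<tau> (Suc i)"
  using assms(2,3)
proof (induction n)
  case 0
  then show ?case using assms(1) by simp
next
  case (Suc n)
  show ?case
  proof (cases "t \<le> \<tau> n")
    case True
    moreover have "t \<notin> \<tau> ` {..n}" using Suc.prems(2) by (auto simp: atMost_Suc)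
    ultimately have "\<exists>i<n. \<tau> i < t \<and> t < \<tau> (Suc i)" by (rule Suc.IH)
    then show ?thesis using less_Suc_eq by blast
  next
    case False
    moreover have "t \<noteq> \<tau> (Suc n)" using Suc.prems(2) by auto
    ultimately show ?thesis using Suc.prems(1) by (intro exI[of _ n]) auto
  qed
qed

lemma piecewise_C1_regular_times:
  assumes "piecewise_C1_curve A \<gamma>"
  shows "\<exists>S. finite S \<and> (\<forall>t\<in>{0..1} - S. regular_time A \<gamma> t)"
proof -
  obtain n \<tau> where \<tau>: "\<tau> 0 = 0" "\<tau> n = (1::real)"
    "\<And>i. i < n \<Longrightarrow> \<tau> i < \<tau> (Suc i) \<and> C1_curve_on A \<gamma> (\<tau> i) (\<tau> (Suc i))"
    using assms by (auto simp: piecewise_C1_curve_def)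
  have "regular_time A \<gamma> t" if "t \<in> {0..1} - \<tau> ` {..n}" for t
  proof -
    have "\<tau> 0 \<le> t" "t \<le> \<tau> n" "t \<notin> \<tau> ` {..n}" using that \<tau>(1,2) by auto
    from in_some_piece[OF this] obtain i where i: "i < n" "\<tau> i < t" "t < \<tau> (Suc i)"
      by blast
    have C1: "C1_curve_on A \<gamma> (\<tau> i) (\<tau> (Suc i))" using \<tau>(3) i by blast
    have within: "at t within {\<tau> i..\<tau> (Suc i)} = at t"
      using i by (intro at_within_interior) auto
    have "isCont \<gamma> t"
      using C1 i within unfolding C1_curve_on_def
      by (metis atLeastAtMost_iff continuous_on_eq_continuous_within less_imp_le)
    moreover have "(chart_map c \<circ> \<gamma>) differentiable (at t)"
      if "c \<in> A" "\<gamma> t \<in> chart_dom c" for c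
    proof -
      obtain D where "\<forall>t\<in>{\<tau> i..\<tau> (Suc i)}. \<gamma> t \<in> chart_dom c \<longrightarrow>
           ((chart_map c \<circ> \<gamma>) has_vector_derivative D t) (at t within {\<tau> i..\<tau> (Suc i)})"
        using C1 \<open>c \<in> A\<close> unfolding C1_curve_on_def by blast
      then have "((chart_map c \<circ> \<gamma>) has_vector_derivative D t) (at t within {\<tau> i..\<tau> (Suc i)})"
        using i that by simp
      then show ?thesis unfolding within by (rule differentiableI_vector)
    qed
    ultimately show ?thesis by (simp add: regular_time_def)
  qed
  then show ?thesis by (intro exI[of _ "\<tau> ` {..n}"]) auto
qed

lemma C1_curve_on_affine:
  assumes "C1_curve_on A \<gamma> a b" "m > 0" "m * a' + r = a" "m * b' + r = b"
    and eq: "\<And>t. t \<in> {a'..b'} \<Longrightarrow> \<gamma>' t = \<gamma> (m * t + r)"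
  shows "C1_curve_on A \<gamma>' a' b'"
proof -
  let ?l = "\<lambda>t. m * t + r"
  have l: "?l t \<in> {a..b}" if "t \<in> {a'..b'}" for t
    using that assms(2) mult_left_mono[of a' t m] mult_left_mono[of t b' m]
    by (simp add: assms(3,4)[symmetric])
  have "continuous_on {a'..b'} (\<lambda>t. \<gamma> (?l t))"
    using assms(1) l unfolding C1_curve_on_def
    by (rule_tac continuous_on_compose2[of "{a..b}" \<gamma>]) (auto intro!: continuous_intros)
  then have "continuous_on {a'..b'} \<gamma>'" by (rule continuous_on_eq) (simp add: eq)
  moreover have "\<exists>D'. continuous_on {t\<in>{a'..b'}. \<gamma>' t \<in> chart_dom c} D' \<and>
        (\<forall>t\<in>{a'..b'}. \<gamma>' t \<in> chart_dom c \<longrightarrow>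
           ((chart_map c \<circ> \<gamma>') has_vector_derivative D' t) (at t within {a'..b'}))"
    if "c \<in> A" for c
  proof -
    obtain D where D: "continuous_on {t\<in>{a..b}. \<gamma> t \<in> chart_dom c} D"
      "\<And>t. t\<in>{a..b} \<Longrightarrow> \<gamma> t \<in> chart_dom c \<Longrightarrow>
           ((chart_map c \<circ> \<gamma>) has_vector_derivative D t) (at t within {a..b})"
      using assms(1) \<open>c \<in> A\<close> unfolding C1_curve_on_def by blast
    have "continuous_on {t\<in>{a'..b'}. \<gamma>' t \<in> chart_dom c} (\<lambda>t. m *\<^sub>R D (?l t))"
      using l eq
      by (intro continuous_on_scaleR continuous_on_const continuous_on_compose2[OF D(1)])
        (auto intro!: continuous_intros)
    moreover have "((chart_map c \<circ> \<gamma>') has_vector_derivative m *\<^sub>R D (?l t)) (at t within {a'..b'})"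
      if t: "t \<in> {a'..b'}" "\<gamma>' t \<in> chart_dom c" for t
    proof -
      have lin: "(?l has_vector_derivative m) (at t within {a'..b'})"
        by (auto intro!: derivative_eq_intros)
      have "((chart_map c \<circ> \<gamma>) has_vector_derivative D (?l t)) (at (?l t) within ?l ` {a'..b'})"
        using D(2)[OF l[OF t(1)]] t eq l by (auto intro: has_vector_derivative_within_subset)
      from vector_diff_chain_within[OF lin this] 
      show ?thesis
        by (rule has_vector_derivative_transform[rotated 2]) (use t eq in auto)
    qed
    ultimately show ?thesis by blast
  qed
  ultimately show ?thesis unfolding C1_curve_on_def by blast
qed

lemma piecewise_C1_curve_join:
  assumes "piecewise_C1_curve A \<gamma>1" "piecewise_C1_curve A \<gamma>2" "\<gamma>1 1 = \<gamma>2 0"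
  shows "piecewise_C1_curve A (\<gamma>1 +++ \<gamma>2)"
proof -
  obtain n1 \<tau>1 where \<tau>1: "\<tau>1 0 = 0" "\<tau>1 n1 = (1::real)"
    "\<And>i. i < n1 \<Longrightarrow> \<tau>1 i < \<tau>1 (Suc i)"
    "\<And>i. i < n1 \<Longrightarrow> C1_curve_on A \<gamma>1 (\<tau>1 i) (\<tau>1 (Suc i))"
    using assms(1) by (auto simp: piecewise_C1_curve_def)
  obtain n2 \<tau>2 where \<tau>2: "\<tau>2 0 = 0" "\<tau>2 n2 = (1::real)"
    "\<And>i. i < n2 \<Longrightarrow> \<tau>2 i < \<tau>2 (Suc i)"
    "\<And>i. i < n2 \<Longrightarrow> C1_curve_on A \<gamma>2 (\<tau>2 i) (\<tau>2 (Suc i))"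
    using assms(2) by (auto simp: piecewise_C1_curve_def)
  have le1: "\<tau>1 i \<le> 1" if "i \<le> n1" for i
    using that
  proof (induction rule: inc_induct)
    case (step i)
    then show ?case using \<tau>1(3)[of i] by linarith
  qed (simp add: \<tau>1)
  have ge0: "i \<le> n2 \<Longrightarrow> 0 \<le> \<tau>2 i" for i
  proof (induction i)
    case (Suc i)
    then show ?case using \<tau>2(3)[of i] by simp
  qed (simp add: \<tau>2)
  define \<tau> where "\<tau> i = (if i \<le> n1 then \<tau>1 i / 2 else (1 + \<tau>2 (i - n1)) / 2)" for i
  have low: "\<tau> i = \<tau>1 i / 2" if "i \<le> n1" for i using that by (simp add: \<tau>_def)
  have high: "\<tau> (n1 + i) = (1 + \<tau>2 i) / 2" for i using \<tau>1 \<tau>2 by (cases i) (auto simp: \<tau>_def)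
  have "\<tau> i < \<tau> (Suc i) \<and> C1_curve_on A (\<gamma>1 +++ \<gamma>2) (\<tau> i) (\<tau> (Suc i))" if "i < n1 + n2" for i
  proof (cases "i < n1")
    case True
    then have [simp]: "\<tau> i = \<tau>1 i / 2" "\<tau> (Suc i) = \<tau>1 (Suc i) / 2" by (auto simp: low)
    have "C1_curve_on A (\<gamma>1 +++ \<gamma>2) (\<tau> i) (\<tau> (Suc i))"
      using True le1[of "Suc i"]
      by (intro C1_curve_on_affine[OF \<tau>1(4)[OF True], of 2 _ 0]) (auto simp: joinpaths_def)
    then show ?thesis using \<tau>1(3)[OF True] by simp
  next
    case False
    define k where "k = i - n1"
    then have k: "i = n1 + k" "k < n2" using that False by auto
    have [simp]: "\<tau> i = (1 + \<tau>2 k) / 2" "\<tau> (Suc i) = (1 + \<tau>2 (Suc k)) / 2"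
      using high[of k] high[of "Suc k"] k by auto
    have "C1_curve_on A (\<gamma>1 +++ \<gamma>2) (\<tau> i) (\<tau> (Suc i))"
    proof (intro C1_curve_on_affine[OF \<tau>2(4)[OF k(2)], of 2 _ "-1"])
      fix t assume "t \<in> {\<tau> i..\<tau> (Suc i)}"
      then have "t \<ge> 1 / 2" using ge0[of k] k(2) by auto
      then show "(\<gamma>1 +++ \<gamma>2) t = \<gamma>2 (2 * t + - 1)"
      proof (cases "t = 1 / 2")
        case True
        show ?thesis unfolding True using assms(3) by (simp add: joinpaths_def)
      qed (simp add: joinpaths_def)
    qed (simp_all add: field_simps)
    then show ?thesis using \<tau>2(3)[OF k(2)] by simp
  qed
  moreover have "\<tau> 0 = 0" "\<tau> (n1 + n2) = 1" using low[of 0] high[of n2] \<tau>1(1) \<tau>2(2) by auto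
  ultimately show ?thesis unfolding piecewise_C1_curve_def by blast
qed

text \<open>
  Integrability passes from \<open>F\<close> to \<open>G\<close>, so that a curve inherits it from a concatenation that it is
  part of.
\<close>

lemma integral_affine_substitution:
  fixes F G :: "real \<Rightarrow> real"
  assumes "F integrable_on {a..b}" "m > 0" "m * a + r = 0" "m * b + r = 1" "finite S"
    and "\<And>t. t \<in> {a..b} - S \<Longrightarrow> F t = m * G (m * t + r)"
  shows "integral {a..b} F = integral {0..1} G"
proof -
  let ?J = "integral {a..b} F"
  have "((\<lambda>t. (1 / m) * F t) has_integral (1 / m) * ?J) {a..b}"
    using assms(1) by (intro has_integral_mult_right) auto
  then have "((\<lambda>t. G (m * t + r)) has_integral (1 / m) * ?J) {a..b}"
    using assms(2,6) by (rule_tac has_integral_spike_finite[OF assms(5)]) auto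
  moreover have "a = (0 - r) / m" "b = (1 - r) / m" using assms(2-4) by (auto simp: field_simps)
  ultimately have "(G has_integral ?J) {0..1}"
    using has_integral_affinity_iff[OF assms(2), of G r ?J 0 1] by (simp add: divide_inverse mult.commute)
  then show ?thesis by (simp add: integral_unique)
qed

text \<open>
  A formulation of \<open>riemannian_dist A g x y < l\<close> that entails the existence of a connecting curve; the
  infimum of the empty set of lengths is unspecified.
\<close>

definition joined_within ::
  "('m::{t2_space,second_countable_topology}, 'e::euclidean_space) chart set
     \<Rightarrow> ('m, 'e) rmetric \<Rightarrow> real \<Rightarrow> 'm \<Rightarrow> 'm \<Rightarrow> bool" where
  "joined_within A g l x y \<longleftrightarrow>
     (\<exists>\<gamma>. piecewise_C1_curve A \<gamma> \<and> \<gamma> 0 = x \<and> \<gamma> 1 = y \<and> curve_length A g \<gamma> < l)"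

context
  fixes A :: "('m::{t2_space,second_countable_topology}, 'e::euclidean_space) chart set"
    and g :: "('m, 'e) rmetric"
  assumes manifold: "riemannian_manifold A g"
begin

lemma exists_chart: "\<exists>c\<in>A. p \<in> chart_dom c"
  using manifold_smooth_atlas[OF manifold] by (auto simp: smooth_atlas_def)

lemma speed_in_chart:
  assumes "c \<in> A" "\<gamma> t \<in> chart_dom c" "isCont \<gamma> t"
    and "((chart_map c \<circ> \<gamma>) has_vector_derivative v) (at t)"
  shows "speed A g \<gamma> t = sqrt (coord_metric A g c (chart_map c (\<gamma> t)) v v)"
  using velocity_eq_coord_tvector[OF manifold_smooth_atlas[OF manifold] assms]
    chart_inv_map[OF manifold_smooth_atlas[OF manifold] assms(1,2)]
  by (simp add: tnorm_def coord_metric_def)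

lemma regular_time_chart:
  assumes "regular_time A \<gamma> t"
  obtains c v where "c \<in> A" "\<gamma> t \<in> chart_dom c" "isCont \<gamma> t"
    "((chart_map c \<circ> \<gamma>) has_vector_derivative v) (at t)"
  using assms exists_chart[of "\<gamma> t"] vector_derivative_works
  by (metis regular_time_def)

lemma speed_nonneg:
  assumes "regular_time A \<gamma> t"
  shows "speed A g \<gamma> t \<ge> 0"
proof -
  obtain c v where "c \<in> A" "\<gamma> t \<in> chart_dom c" "isCont \<gamma> t"
    "((chart_map c \<circ> \<gamma>) has_vector_derivative v) (at t)"
    using regular_time_chart[OF assms] by blast
  then have "velocity A \<gamma> t \<in> tangent_space A (\<gamma> t)"
    using velocity_eq_coord_tvector[OF manifold_smooth_atlas[OF manifold]]
      coord_tvector_in_tangent_space[OF manifold_smooth_atlas[OF manifold]] by metis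
  then show ?thesis by (rule tnorm_nonneg[OF manifold])
qed

lemma speed_affine:
  assumes "regular_time A \<gamma> (m * t + r)" "m > 0" "open U" "t \<in> U"
    and eq: "\<And>s. s \<in> U \<Longrightarrow> \<gamma>' s = \<gamma> (m * s + r)"
  shows "speed A g \<gamma>' t = m * speed A g \<gamma> (m * t + r)"
proof -
  let ?l = "\<lambda>s. m * s + r"
  obtain c v where c: "c \<in> A" "\<gamma> (?l t) \<in> chart_dom c" "isCont \<gamma> (?l t)"
    and v: "((chart_map c \<circ> \<gamma>) has_vector_derivative v) (at (?l t))"
    using regular_time_chart[OF assms(1)] by blast
  have ev: "\<forall>\<^sub>F s in nhds t. \<gamma>' s = \<gamma> (?l s)"
    using eq assms(3,4) eventually_nhds by blast
  have "isCont ?l t" by (intro continuous_intros)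
  from isCont_o2[OF this c(3)] have cont: "isCont \<gamma>' t"
    by (rule iffD2[OF isCont_cong[OF ev]])
  have "(?l has_vector_derivative m) (at t)" by (auto intro!: derivative_eq_intros)
  from vector_diff_chain_at[OF this v]
  have v': "((chart_map c \<circ> \<gamma>') has_vector_derivative m *\<^sub>R v) (at t)"
    by (rule has_vector_derivative_transform_within_open[OF _ assms(3,4)]) (simp add: eq)
  have x: "chart_map c (\<gamma> (?l t)) \<in> chart_map c ` chart_dom c" using c by blast
  have "coord_metric A g c (chart_map c (\<gamma> (?l t))) (m *\<^sub>R v) (m *\<^sub>R v)
      = m\<^sup>2 * coord_metric A g c (chart_map c (\<gamma> (?l t))) v v"
    using linear_cmul[OF coord_metric_linear(1)[OF manifold c(1) x]]
      linear_cmul[OF coord_metric_linear(2)[OF manifold c(1) x]]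
    by (simp add: power2_eq_square)
  then show ?thesis
    using speed_in_chart[OF c v] speed_in_chart[OF c(1) _ cont v'] c(2) assms(2) eq[OF assms(4)]
    by (simp add: real_sqrt_mult)
qed

text \<open>
  Away from finitely many times the velocity is tangent, so the metric is nonnegative on it; if the
  speed were not integrable, the length would be the default value \<open>0\<close> of the integral.
\<close>

lemma curve_length_nonneg:
  assumes "piecewise_C1_curve A \<gamma>"
  shows "curve_length A g \<gamma> \<ge> 0"
proof (cases "speed A g \<gamma> integrable_on {0..1}")
  case True
  obtain S where S: "finite S" "\<And>t. t \<in> {0..1} - S \<Longrightarrow> regular_time A \<gamma> t"
    using piecewise_C1_regular_times[OF assms] by blast
  have "((\<lambda>t. if t \<in> S then 0 else speed A g \<gamma> t) has_integral curve_length A g \<gamma>) {0..1}"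
    using True S(1) unfolding curve_length_def
    by (rule_tac has_integral_spike_finite[of S]) auto
  then show ?thesis
    by (rule has_integral_nonneg) (use S speed_nonneg in auto)
next
  case False
  then show ?thesis by (simp add: curve_length_def not_integrable_integral)
qed

text \<open>
  Each half of the concatenation is an affine reparametrization and has the length of the corresponding
  curve if the speed of the concatenation is integrable.  Otherwise the left-hand side is the default
  value \<open>0\<close>.  The inequality is the form in which the triangle inequality for the distance needs this.
\<close>

lemma curve_length_join_le:
  assumes "piecewise_C1_curve A \<gamma>1" "piecewise_C1_curve A \<gamma>2"
  shows "curve_length A g (\<gamma>1 +++ \<gamma>2) \<le> curve_length A g \<gamma>1 + curve_length A g \<gamma>2"
proof (cases "speed A g (\<gamma>1 +++ \<gamma>2) integrable_on {0..1}")
  case True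
  let ?F = "speed A g (\<gamma>1 +++ \<gamma>2)"
  obtain S1 where S1: "finite S1" "\<And>t. t \<in> {0..1} - S1 \<Longrightarrow> regular_time A \<gamma>1 t"
    using piecewise_C1_regular_times[OF assms(1)] by blast
  obtain S2 where S2: "finite S2" "\<And>t. t \<in> {0..1} - S2 \<Longrightarrow> regular_time A \<gamma>2 t"
    using piecewise_C1_regular_times[OF assms(2)] by blast
  have int: "?F integrable_on {0..1/2}" "?F integrable_on {1/2..1}"
    using True by (auto intro: integrable_subinterval_real)
  have "integral {0..1/2} ?F = curve_length A g \<gamma>1"
    unfolding curve_length_def
  proof (rule integral_affine_substitution[where m=2 and r=0 and S="insert (1/2) ((\<lambda>t. t / 2) ` S1)"])
    fix t :: real assume t: "t \<in> {0..1/2} - insert (1/2) ((\<lambda>t. t / 2) ` S1)"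
    then have "2 * t \<notin> S1" using imageI[of "2 * t" S1 "\<lambda>t. t / 2"] by auto
    then have "regular_time A \<gamma>1 (2 * t + 0)" using t S1(2) by auto
    then show "?F t = 2 * speed A g \<gamma>1 (2 * t + 0)"
      using t by (intro speed_affine[where U="{..<1/2}"]) (auto simp: joinpaths_def)
  qed (use int S1 in auto)
  moreover have "integral {1/2..1} ?F = curve_length A g \<gamma>2"
    unfolding curve_length_def
  proof (rule integral_affine_substitution[where m=2 and r="-1" and S="insert (1/2) ((\<lambda>t. (t + 1) / 2) ` S2)"])
    fix t :: real assume t: "t \<in> {1/2..1} - insert (1/2) ((\<lambda>t. (t + 1) / 2) ` S2)"
    then have "2 * t + -1 \<notin> S2" using imageI[of "2 * t + -1" S2 "\<lambda>t. (t + 1) / 2"] by auto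
    then have "regular_time A \<gamma>2 (2 * t + -1)" using t S2(2) by auto
    then show "?F t = 2 * speed A g \<gamma>2 (2 * t + -1)"
      using t by (intro speed_affine[where U="{1/2<..}"]) (auto simp: joinpaths_def)
  qed (use int S2 in auto)
  ultimately show ?thesis
    using Henstock_Kurzweil_Integration.integral_combine[OF _ _ True, of "1/2"]
    by (simp add: curve_length_def)
next
  case False
  then have "curve_length A g (\<gamma>1 +++ \<gamma>2) = 0" by (simp add: curve_length_def not_integrable_integral)
  then show ?thesis using assms[THEN curve_length_nonneg] by linarith
qed

text \<open>
  The straight segments of a chart are short curves: where the first fundamental form is bounded by \<open>C\<close>,
  the speed of a segment is at most \<open>sqrt C\<close> times its Euclidean speed.
\<close>

lemma chart_segment:
  assumes c: "c \<in> A" and K: "convex K" "K \<subseteq> chart_map c ` chart_dom c" "a \<in> K" "b \<in> K"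
    and C: "C \<ge> 0" "\<And>x v. x \<in> K \<Longrightarrow> coord_metric A g c x v v \<le> C * (norm v)\<^sup>2"
  defines "\<gamma> \<equiv> \<lambda>t. chart_inv c (a + t *\<^sub>R (b - a))"
  shows "piecewise_C1_curve A \<gamma>" "curve_length A g \<gamma> \<le> sqrt C * norm (b - a)"
proof -
  let ?l = "\<lambda>t. a + t *\<^sub>R (b - a)"
  note at = manifold_smooth_atlas[OF manifold]
  have lK: "?l t \<in> K" if "t \<in> {0..1}" for t
  proof -
    have "?l t = (1 - t) *\<^sub>R a + t *\<^sub>R b" by (simp add: algebra_simps)
    then show ?thesis using K(1,3,4) that by (simp add: convexD_alt)
  qed
  have l: "?l t \<in> chart_map c ` chart_dom c" if "t \<in> {0..1}" for t
    using lK[OF that] K(2) by blast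
  have \<gamma>c: "\<gamma> t \<in> chart_dom c" "chart_map c (\<gamma> t) = ?l t" if "t \<in> {0..1}" for t
    using l[OF that] chart_inv_map[OF at c] by (auto simp: \<gamma>_def)
  have cont: "continuous_on {0..1} \<gamma>"
    unfolding \<gamma>_def using l
    by (intro continuous_on_compose2[OF homeomorphism_cont2[OF chart_homeomorphism[OF at c]]]
        continuous_intros) auto
  have lin: "(?l has_vector_derivative b - a) (at t within S)" for t S
    by (auto intro!: derivative_eq_intros)
  have vd: "((chart_map c \<circ> \<gamma>) has_vector_derivative b - a) (at t within {0..1})" if "t \<in> {0..1}" for t
    by (rule has_vector_derivative_transform[OF that _ lin]) (simp add: \<gamma>c)
  have "C1_curve_on A \<gamma> 0 1"
    unfolding C1_curve_on_def
  proof (intro conjI ballI cont)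
    fix c' assume c': "c' \<in> A"
    let ?D = "\<lambda>t. frechet_derivative (chart_map c' \<circ> chart_inv c) (at (?l t)) (b - a)"
    have "continuous_on {t\<in>{0..1}. \<gamma> t \<in> chart_dom c'} ?D"
    proof (intro continuous_on_compose2[OF continuous_transition_derivative[OF at c c', of "b - a"], of _ ?l]
        continuous_intros subsetI)
      fix x assume "x \<in> ?l ` {t\<in>{0..1}. \<gamma> t \<in> chart_dom c'}"
      then obtain t where "t \<in> {0..1}" "\<gamma> t \<in> chart_dom c'" "x = ?l t" by blast
      then show "x \<in> chart_map c ` (chart_dom c \<inter> chart_dom c')"
        using \<gamma>c[of t] by (metis IntI imageI)
    qed
    moreover have "((chart_map c' \<circ> \<gamma>) has_vector_derivative ?D t) (at t within {0..1})"
      if "t \<in> {0..1}" "\<gamma> t \<in> chart_dom c'" for t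
      using has_vector_derivative_other_chart[OF at c c', of \<gamma> t "{0..1}" "b - a"] \<gamma>c[OF that(1)] that vd cont
      by (auto simp: continuous_on_eq_continuous_within)
    ultimately show "\<exists>D. continuous_on {t\<in>{0..1}. \<gamma> t \<in> chart_dom c'} D \<and>
        (\<forall>t\<in>{0..1}. \<gamma> t \<in> chart_dom c' \<longrightarrow>
           ((chart_map c' \<circ> \<gamma>) has_vector_derivative D t) (at t within {0..1}))" by blast
  qed
  then show pw: "piecewise_C1_curve A \<gamma>"
    unfolding piecewise_C1_curve_def by (intro exI[of _ "1::nat"] exI[of _ real]) auto
  have speed: "norm (speed A g \<gamma> t) \<le> sqrt C * norm (b - a)" if "t \<in> cbox 0 1 - {0, 1}" for t
  proof -
    have t: "t \<in> {0..1}" and within: "at t within {0..1} = at t"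
      using that by (auto intro!: at_within_interior)
    have "isCont \<gamma> t" using cont t within by (metis continuous_on_eq_continuous_within)
    then have sp: "speed A g \<gamma> t = sqrt (coord_metric A g c (?l t) (b - a) (b - a))"
      using speed_in_chart[where \<gamma>=\<gamma> and t=t, OF c \<gamma>c(1)[OF t]] vd[OF t] \<gamma>c(2)[OF t] unfolding within by simp
    also have "\<dots> \<le> sqrt (C * (norm (b - a))\<^sup>2)" using C(2)[OF lK[OF t]] by simp
    also have "\<dots> = sqrt C * norm (b - a)" by (simp add: real_sqrt_mult)
    finally have "speed A g \<gamma> t \<le> sqrt C * norm (b - a)" .
    moreover have "regular_time A \<gamma> t"
      unfolding regular_time_def
    proof (intro conjI ballI impI \<open>isCont \<gamma> t\<close>)
      fix c' assume "c' \<in> A" "\<gamma> t \<in> chart_dom c'"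
      then show "(chart_map c' \<circ> \<gamma>) differentiable (at t)"
        using has_vector_derivative_other_chart[OF at c, of c' \<gamma> t UNIV "b - a"] \<gamma>c(1)[OF t]
          \<open>isCont \<gamma> t\<close> vd[OF t] differentiableI_vector unfolding within by blast
    qed
    ultimately show ?thesis using speed_nonneg by auto
  qed
  show "curve_length A g \<gamma> \<le> sqrt C * norm (b - a)"
  proof (cases "speed A g \<gamma> integrable_on {0..1}")
    case True
    then have "(speed A g \<gamma> has_integral curve_length A g \<gamma>) (cbox 0 1)"
      by (simp add: curve_length_def has_integral_integral)
    from has_integral_bound_spike_finite[where S="{0, 1}", OF _ _ this speed]
    show ?thesis using C(1) by auto
  next
    case False
    then show ?thesis using C(1) by (simp add: curve_length_def not_integrable_integral)
  qed
qed

section \<open>The Riemannian distance\<close>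

lemma joined_within_trans:
  assumes "joined_within A g l x y" "joined_within A g k y z"
  shows "joined_within A g (l + k) x z"
proof -
  obtain \<gamma>1 \<gamma>2 where "piecewise_C1_curve A \<gamma>1" "\<gamma>1 0 = x" "\<gamma>1 1 = y" "curve_length A g \<gamma>1 < l"
    "piecewise_C1_curve A \<gamma>2" "\<gamma>2 0 = y" "\<gamma>2 1 = z" "curve_length A g \<gamma>2 < k"
    using assms unfolding joined_within_def by blast
  then show ?thesis
    using piecewise_C1_curve_join[of A \<gamma>1 \<gamma>2] curve_length_join_le[of \<gamma>1 \<gamma>2]
    unfolding joined_within_def by (intro exI[of _ "\<gamma>1 +++ \<gamma>2"]) (auto simp: joinpaths_def)
qed

text \<open>
  The manifold topology is at least as fine as the one of the Riemannian distance.
\<close>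

lemma locally_joined_within:
  assumes "\<epsilon> > 0"
  shows "\<exists>U. open U \<and> p \<in> U \<and> (\<forall>q\<in>U. joined_within A g \<epsilon> p q \<and> joined_within A g \<epsilon> q p)"
proof -
  note at = manifold_smooth_atlas[OF manifold]
  obtain c where c: "c \<in> A" "p \<in> chart_dom c" using exists_chart by blast
  let ?x = "chart_map c p"
  have "open (chart_map c ` chart_dom c)" using open_chart_image open_chart_dom at c by blast
  then obtain r where r: "r > 0" "cball ?x r \<subseteq> chart_map c ` chart_dom c"
    using c(2) open_contains_cball by blast
  obtain C where C: "C \<ge> 0" "\<And>x v. x \<in> cball ?x r \<Longrightarrow> coord_metric A g c x v v \<le> C * (norm v)\<^sup>2"
    using coord_metric_bounded[OF manifold c(1) compact_cball r(2)] by blast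
  \<comment> \<open>the summand \<open>1\<close> keeps the denominator positive, since \<open>C\<close> may be \<open>0\<close>\<close>
  define s where "s = min r (\<epsilon> / (sqrt C + 1))"
  have pos: "sqrt C + 1 > 0" using C(1) by (simp add: add_nonneg_pos)
  then have s: "s > 0" using r(1) assms by (simp add: s_def)
  define U where "U = chart_dom c \<inter> chart_map c -` ball ?x s"
  have "open U"
    unfolding U_def using homeomorphism_cont1[OF chart_homeomorphism[OF at c(1)]] open_chart_dom[OF at c(1)]
    by (simp add: continuous_open_preimage)
  moreover have "p \<in> U" using c s by (simp add: U_def)
  moreover have "joined_within A g \<epsilon> y z"
    if "y \<in> chart_dom c" "z \<in> chart_dom c" "chart_map c y \<in> cball ?x r" "chart_map c z \<in> cball ?x r"
      "norm (chart_map c z - chart_map c y) < s" for y z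
  proof -
    let ?\<gamma> = "\<lambda>t. chart_inv c (chart_map c y + t *\<^sub>R (chart_map c z - chart_map c y))"
    have "sqrt C * norm (chart_map c z - chart_map c y) \<le> sqrt C * s"
      using that(5) C(1) by (intro mult_left_mono) auto
    also have "\<dots> < (sqrt C + 1) * s" using s by (simp add: algebra_simps)
    also have "\<dots> \<le> (sqrt C + 1) * (\<epsilon> / (sqrt C + 1))"
      using pos by (intro mult_left_mono) (auto simp: s_def)
    also have "\<dots> = \<epsilon>" using pos by simp
    finally have "sqrt C * norm (chart_map c z - chart_map c y) < \<epsilon>" .
    then show ?thesis
      unfolding joined_within_def
      using chart_segment[OF c(1) convex_cball r(2) that(3,4) C] chart_inv_map[OF at c(1)] that(1,2)
      by (intro exI[of _ ?\<gamma>]) auto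
  qed
  ultimately show ?thesis
    using c r(1) s by (intro exI[of _ U]) (auto simp: U_def s_def dist_norm norm_minus_commute)
qed

text \<open>
  Being joined by curves in both directions is an equivalence relation with open classes, and on a
  connected space there is only one such class.
\<close>

lemma all_joined:
  assumes "connected (UNIV :: 'm set)"
  shows "\<exists>l. joined_within A g l x y"
proof -
  let ?R = "\<lambda>x y. (\<exists>l. joined_within A g l x y) \<and> (\<exists>l. joined_within A g l y x)"
  have "?R x y"
  proof (rule connected_equivalence_relation[OF assms, of x y ?R])
    show "\<exists>T. openin (top_of_set UNIV) T \<and> a \<in> T \<and> (\<forall>x\<in>T. ?R a x)" for a
      using locally_joined_within[of 1 a] by auto
  qed (use joined_within_trans in blast)+
  then show ?thesis by blast
qed

lemma riemannian_dist_less: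
  assumes "joined_within A g l x y"
  shows "riemannian_dist A g x y < l"
proof -
  let ?L = "{curve_length A g \<gamma> | \<gamma>. piecewise_C1_curve A \<gamma> \<and> \<gamma> 0 = x \<and> \<gamma> 1 = y}"
  have "bdd_below ?L" using curve_length_nonneg by (intro bdd_belowI[of _ 0]) auto
  then show ?thesis
    using assms unfolding joined_within_def riemannian_dist_def
    by (metis (mono_tags, lifting) cInf_lower le_less_trans mem_Collect_eq)
qed

lemma joined_within_riemannian_dist:
  assumes "connected (UNIV :: 'm set)" "riemannian_dist A g x y < l"
  shows "joined_within A g l x y"
proof -
  let ?L = "{curve_length A g \<gamma> | \<gamma>. piecewise_C1_curve A \<gamma> \<and> \<gamma> 0 = x \<and> \<gamma> 1 = y}"
  have "?L \<noteq> {}" using all_joined[OF assms(1), of x y] by (auto simp: joined_within_def)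
  from cInf_lessD[OF this assms(2)[unfolded riemannian_dist_def]]
  obtain k where "k \<in> ?L" "k < l" by blast
  then show ?thesis by (auto simp: joined_within_def)
qed

lemma riemannian_dist_triangle:
  assumes "connected (UNIV :: 'm set)"
  shows "riemannian_dist A g x z \<le> riemannian_dist A g x y + riemannian_dist A g y z"
proof (rule field_le_epsilon)
  fix e :: real assume "e > 0"
  then have "joined_within A g (riemannian_dist A g x y + e / 2) x y"
    "joined_within A g (riemannian_dist A g y z + e / 2) y z"
    by (auto intro: joined_within_riemannian_dist[OF assms])
  from riemannian_dist_less[OF joined_within_trans[OF this]]
  show "riemannian_dist A g x z \<le> riemannian_dist A g x y + riemannian_dist A g y z + e"
    by simp
qed

lemma riemannian_dist_refl: "riemannian_dist A g x x = 0"
proof (rule antisym)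
  show "riemannian_dist A g x x \<le> 0"
  proof (rule field_le_epsilon)
    fix e :: real assume "e > 0"
    then show "riemannian_dist A g x x \<le> 0 + e"
      using locally_joined_within[of e x] riemannian_dist_less[of e x x] by fastforce
  qed
  have "{curve_length A g \<gamma> | \<gamma>. piecewise_C1_curve A \<gamma> \<and> \<gamma> 0 = x \<and> \<gamma> 1 = x} \<noteq> {}"
    using locally_joined_within[of 1 x] by (auto simp: joined_within_def)
  then show "0 \<le> riemannian_dist A g x x"
    unfolding riemannian_dist_def using curve_length_nonneg by (intro cInf_greatest) auto
qed

end


section \<open>The specification property\<close>

lemma contracting_branches_expanding_maps:
  assumes "f \<in> expanding_maps A g \<sigma> \<rho>"
  shows "contracting_branches (riemannian_dist A g) \<sigma> \<rho> f"
  unfolding contracting_branches_def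
proof
  fix x
  have "\<forall>y x. f x = y \<longrightarrow>
     (\<exists>h. C1_map_on A (rball A g y \<rho>) h \<and> (\<forall>z\<in>rball A g y \<rho>. f (h z) = z) \<and> h y = x \<and>
        (\<forall>y1\<in>rball A g y \<rho>. \<forall>y2\<in>rball A g y \<rho>.
           riemannian_dist A g (h y1) (h y2) \<le> inverse \<sigma> * riemannian_dist A g y1 y2))"
    using assms unfolding expanding_maps_def by (elim CollectE conjE)
  then obtain h where "\<forall>z\<in>rball A g (f x) \<rho>. f (h z) = z" "h (f x) = x"
    "\<forall>y1\<in>rball A g (f x) \<rho>. \<forall>y2\<in>rball A g (f x) \<rho>.
       riemannian_dist A g (h y1) (h y2) \<le> inverse \<sigma> * riemannian_dist A g y1 y2"
    by blast
  then show "\<exists>h. h (f x) = x \<and> (\<forall>z. riemannian_dist A g (f x) z < \<rho> \<longrightarrow> f (h z) = z) \<and>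
        (\<forall>z z'. riemannian_dist A g (f x) z < \<rho> \<longrightarrow> riemannian_dist A g (f x) z' < \<rho> \<longrightarrow>
           riemannian_dist A g (h z) (h z') \<le> riemannian_dist A g z z' / \<sigma>)"
    by (intro exI[of _ h]) (simp add: rball_def divide_inverse mult.commute)
qed

theorem theorem6p5:
  fixes A :: "('m::{t2_space,second_countable_topology}, 'e::euclidean_space) chart set"
    and g :: "('m, 'e) rmetric"
    and I :: "nat \<Rightarrow> 'i set"
    and \<Phi> :: "nat \<Rightarrow> 'i \<Rightarrow> 'm \<Rightarrow> 'm"
    and \<sigma> \<rho> :: real
  assumes "riemannian_manifold A g"
    and "compact (UNIV :: 'm set)"
    and "connected (UNIV :: 'm set)"
    and "naifs I \<Phi>"
    and "\<sigma> > 1"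
    and "\<rho> > 0"
    and "uniformly_expanding A g \<sigma> \<rho> I \<Phi>"
  shows "specification_property (riemannian_dist A g) I \<Phi>"
proof (rule specification_of_contracting_branches[where \<sigma>=\<sigma> and \<rho>=\<rho>])
  show "\<exists>U. open U \<and> p \<in> U \<and>
      (\<forall>q\<in>U. riemannian_dist A g p q < \<rho> \<and> riemannian_dist A g q p < \<rho>)" for p
    using locally_joined_within[OF assms(1,6), of p] riemannian_dist_less[OF assms(1)] by meson
  show "contracting_branches (riemannian_dist A g) \<sigma> \<rho> (\<Phi> j i)" if "j \<ge> 1" "i \<in> I j" for j i
    using assms(7) that by (simp add: uniformly_expanding_def contracting_branches_expanding_maps)
qed (use assms riemannian_dist_refl[OF assms(1)] riemannian_dist_triangle[OF assms(1,3)] in auto)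

end
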